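(* There is an absolute constant $C_0$ such that the following holds. Let $2<s<\infty$, $0<\gamma<1$, $K>0$, $0<\xi<\frac1{1000}$, let $\alpha$ be an irrational number of bounded type with convergents $p_m/q_m$, and let $C\ge C_0$, $c>0$. There are $\lambda_0>1$ and $c'>0$, independent of $m$ and $n$, such that for all $\lambda\ge\lambda_0$, $m\ge1$ and $n\ge2$ with $n-1\le q_m^C$: let $I$ be an interval and let $E^\ell\in G^{s,K}(I,SL(2,\mathbb{R}))$, $0\le\ell\le n-1$. Put $e^\ell(x)=\|E^\ell(x)\|$, $s^\ell(x)=s(E^\ell(x))$, $u^\ell(x)=u(E^\ell(x))$ and, for $1\le\ell\le n-1$, $\theta_\ell(x)=u^{\ell-1}(x)-s^\ell(x)+\frac\pi2$. Assume that for $1\le\ell\le n-1$ $$\inf_{x\in I}\left|\tfrac\pi2-\theta_\ell(x)\right|=\inf_{x\in I}\left|s^\ell(x)-u^{\ell-1}(x)\right|\ge c\,e^{-q_m^\gamma}\gg\min_{0\le j\le n-1}\left\{\inf_{x\in I}e^j(x)\right\}^{-\frac1{100}},$$ $$\left|\tfrac1{\cos\theta_\ell}\right|_{s,K},\ |\tan\theta_\ell|_{s,K}\le Ce^{q_m^\gamma},\qquad|\cos\theta_\ell|_{s,K},\ |\cot\theta_\ell|_{s,K}\le C,$$ and that for $0\le\ell\le n-1$ $$|(e^\ell)^{-1}|_{s,K}\le\left(|e^\ell|_{s,K}\right)^{-1+\xi}\le C\lambda^{-\frac13q_{m-1}} .$$ Let $E_n^0(x)=E^{n-1}(x)\cdots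 E^1(x)E^0(x)$, $e_n^0(x)=\|E_n^0(x)\|$, $s_n^0(x)=s(E_n^0(x))$, $u_n^n(x)=u(E_n^0(x))$, and $\eta=\lambda^{-\frac1{8000}q_{m-1}}$. Then $$\inf_{x\in I}e_n^0(x)\ge(c')^ne^{-2nq_m^\gamma}\prod_{\ell=0}^{n-1}\inf_{x\in I}e^\ell(x),$$ $$|e_n^0|_{s,(1+\eta)K}\le C^{2n}\prod_{\ell=0}^{n-1}|e^\ell|_{s,K},$$ $$|(e_n^0)^{-1}|_{s,(1+\eta)K}\le C^{2n}e^{4nq_m^\gamma}\prod_{\ell=0}^{n-1}|(e^\ell)^{-1}|_{s,K},$$ $$|s^0-s_n^0|_{s,(1+\eta)K}\le\lambda^{-\frac1{10}q_{m-1}},\qquad|u^{n-1}-u_n^n|_{s,(1+\eta)K}\le\lambda^{-\frac1{10}q_{m-1}} .$$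
   Context: For an interval $I$ and smooth $f:I\to\mathbb{R}$, $$|f|_{s,K}=\frac{4\pi^2}{3}\sup_{k\ge0}\frac{(1+k)^2}{K^k(k!)^s}\sup_{x\in I}|\partial^kf(x)|,$$ $G^{s,K}(I)$ is the set of smooth $f$ with $|f|_{s,K}<\infty$, and $G^{s,K}(I,SL(2,\mathbb{R}))$ is the set of $SL(2,\mathbb{R})$-valued maps with entries in $G^{s,K}(I)$. (The subscript $s$ is the Gevrey exponent, distinct from the angle functions $s^\ell$, $s_n^0$.) $(e^\ell)^{-1}$ and $(e_n^0)^{-1}$ denote reciprocals. $R_\theta=\begin{pmatrix}\cos\theta&-\sin\theta\\\sin\theta&\cos\theta\end{pmatrix}$. For $A\in SL(2,\mathbb{R})$ with $\|A\|>1$ (operator norm), $s(A)\in\mathbb{R}/\pi\mathbb{Z}$ is the angle of the most contracted direction, i.e. a unit vector $\hat s$ in direction $s(A)$ satisfies $\|A\hat s\|=\|A\|^{-1}$; and $u(A)=s(A^{-1})$. Thus $A=R_u\,\mathrm{diag}(\|A\|,\|A\|^{-1})R_{\frac\pi2-s}$ up to sign. The angles $s^\ell,u^\ell$ are represented by smooth real-valued lifts on $I$ (and $\theta_\ell$ is formed with these), and the differences $s^0-s_n^0$, $u^{n-1}-u_n^n$ by their real representatives in $(-\pi/2,\pi/2]$. An irrational $\alpha$ is of bounded type if $q_{m+1}\le Mq_m$ for all $m$ and some $M>0$. $A\gg B$ for positive quantities means $A\ge C_1B$ for a sufficiently large constant $C_1$. *)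

theory Defs
  imports "HOL-Analysis.Analysis"
begin

text \<open>Derivatives are taken within \<open>I\<close>, hence one-sided at an endpoint belonging to \<open>I\<close>.
  They are unique because intervals are required to be nondegenerate where these notions are used.\<close>

definition deriv_on :: "real set \<Rightarrow> nat \<Rightarrow> (real \<Rightarrow> real) \<Rightarrow> real \<Rightarrow> real" where
  "deriv_on I k f = ((\<lambda>g x. vector_derivative g (at x within I)) ^^ k) f"

definition smooth_fun_on :: "real set \<Rightarrow> (real \<Rightarrow> real) \<Rightarrow> bool" where
  "smooth_fun_on I f \<longleftrightarrow> (\<forall>k. \<forall>x\<in>I. deriv_on I k f differentiable (at x within I))"

text \<open>The Gevrey norm, extended by \<open>\<infinity>\<close> to functions that are not smooth on \<open>I\<close>: a finite upper
  bound on \<open>gevrey_norm I s K f\<close> therefore includes the assertion that \<open>f\<close> is smooth on \<open>I\<close>.\<close>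

definition gevrey_norm :: "real set \<Rightarrow> real \<Rightarrow> real \<Rightarrow> (real \<Rightarrow> real) \<Rightarrow> ennreal" where
  "gevrey_norm I s K f =
     (if smooth_fun_on I f
      then ennreal (4 * pi\<^sup>2 / 3) *
           (SUP k. ennreal ((1 + real k)\<^sup>2 / (K ^ k * fact k powr s)) *
                   (SUP x\<in>I. ennreal \<bar>deriv_on I k f x\<bar>))
      else \<infinity>)"

definition gevrey :: "real set \<Rightarrow> real \<Rightarrow> real \<Rightarrow> (real \<Rightarrow> real) set" where
  "gevrey I s K = {f. smooth_fun_on I f \<and> gevrey_norm I s K f < \<infinity>}"

definition gevrey_SL2 :: "real set \<Rightarrow> real \<Rightarrow> real \<Rightarrow> (real \<Rightarrow> real^2^2) set" where
  "gevrey_SL2 I s K =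
     {E. (\<forall>x\<in>I. det (E x) = 1) \<and> (\<forall>i j. (\<lambda>x. E x $ i $ j) \<in> gevrey I s K)}"

definition opnorm :: "real^2^2 \<Rightarrow> real" where
  "opnorm A = onorm (\<lambda>v. A *v v)"

text \<open>An element of \<open>\<real>/\<pi>\<int>\<close> is represented by the set of its real representatives.
  For \<open>A\<close> of determinant 1 with \<open>opnorm A > 1\<close>, both sets below are cosets of \<open>\<pi>\<int>\<close>;
  for \<open>opnorm A = 1\<close> they are all of \<open>\<real>\<close>.\<close>

definition contracted_angle :: "real^2^2 \<Rightarrow> real set" where
  "contracted_angle A = {t. norm (A *v vector [cos t, sin t]) = inverse (opnorm A)}"

definition expanded_angle :: "real^2^2 \<Rightarrow> real set" where
  "expanded_angle A = contracted_angle (matrix_inv A)"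

text \<open>The real representative in \<open>(-\<pi>/2, \<pi>/2]\<close> of the difference of two cosets of \<open>\<pi>\<int>\<close>.\<close>

definition angle_diff :: "real set \<Rightarrow> real set \<Rightarrow> real" where
  "angle_diff S T = (THE d. - pi / 2 < d \<and> d \<le> pi / 2 \<and> (\<exists>a\<in>S. \<exists>b\<in>T. d = a - b))"

definition smooth_lift_on :: "real set \<Rightarrow> (real \<Rightarrow> real set) \<Rightarrow> (real \<Rightarrow> real) \<Rightarrow> bool" where
  "smooth_lift_on I S t \<longleftrightarrow> smooth_fun_on I t \<and> (\<forall>x\<in>I. t x \<in> S x)"

text \<open>\<open>iter_prod E n x = E (n-1) x ** \<dots> ** E 1 x ** E 0 x\<close>\<close>

primrec iter_prod :: "(nat \<Rightarrow> real \<Rightarrow> real^2^2) \<Rightarrow> nat \<Rightarrow> real \<Rightarrow> real^2^2" where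
  "iter_prod E 0 x = mat 1"
| "iter_prod E (Suc n) x = E n x ** iter_prod E n x"

text \<open>Continued fraction \<open>\<alpha> = [a\<^sub>0; a\<^sub>1, a\<^sub>2, \<dots>]\<close> of an irrational \<open>\<alpha>\<close>, and the denominators
  \<open>q\<^sub>m\<close> of its convergents \<open>p\<^sub>m/q\<^sub>m = [a\<^sub>0; a\<^sub>1, \<dots>, a\<^sub>m]\<close>, so \<open>q\<^sub>0 = 1\<close> and \<open>q\<^sub>1 = a\<^sub>1\<close>.\<close>

primrec cf_complete_quotient :: "real \<Rightarrow> nat \<Rightarrow> real" where
  "cf_complete_quotient \<alpha> 0 = \<alpha>"
| "cf_complete_quotient \<alpha> (Suc k) = 1 / frac (cf_complete_quotient \<alpha> k)"

definition cf_partial_quotient :: "real \<Rightarrow> nat \<Rightarrow> int" where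
  "cf_partial_quotient \<alpha> k = \<lfloor>cf_complete_quotient \<alpha> k\<rfloor>"

fun cf_denom :: "real \<Rightarrow> nat \<Rightarrow> int" where
  "cf_denom \<alpha> 0 = 1"
| "cf_denom \<alpha> (Suc 0) = cf_partial_quotient \<alpha> 1"
| "cf_denom \<alpha> (Suc (Suc k)) =
     cf_partial_quotient \<alpha> (Suc (Suc k)) * cf_denom \<alpha> (Suc k) + cf_denom \<alpha> k"

definition bounded_type :: "real \<Rightarrow> bool" where
  "bounded_type \<alpha> \<longleftrightarrow>
     \<alpha> \<notin> \<rat> \<and> (\<exists>M>0. \<forall>m. real_of_int (cf_denom \<alpha> (Suc m)) \<le> M * real_of_int (cf_denom \<alpha> m))"

end

theory Submission
  imports Defs
begin

text \<open>
A matrix of determinant 1 is, up to sign, \<open>R\<^sub>u diag(a, 1/a) R\<^bsub>\<pi>/2 - s\<^esub>\<close>, where \<open>a\<close> is its norm,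
\<open>s\<close> its contracted and \<open>u\<close> its expanded direction. In a product of two such matrices the inner
rotations combine to \<open>R\<^sub>\<theta>\<close>, and everything about the product is contained in the middle factor
\<open>diag(b, 1/b) R\<^sub>\<theta> diag(a, 1/a)\<close>. Its conformal and anticonformal parts are explicit, and their
polar coordinates are the sum and the difference of the singular values and of the angles
(\<open>conformal_decomposition\<close>). This gives exact formulas (\<open>has_svd_mult\<close>): the norm of the product
is \<open>a b \<bar>cos \<theta>\<bar>\<close> times a factor close to 1, and the outer directions are displaced by
arctangents of quantities of size \<open>(1/a\<^sup>2 + 1/b\<^sup>2) tan \<theta>\<close>.

The formulas contain only products, reciprocals, square roots, arctangents and the functions
\<open>1/a\<close>, \<open>1/b\<close>, \<open>cos \<theta>\<close>, \<open>1/cos \<theta>\<close>, \<open>tan \<theta>\<close> whose Gevrey norms are controlled. The weights in the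
Gevrey norm make it submultiplicative (\<open>bd_mult\<close>) and complete (\<open>bd_sums\<close>), so that it behaves as
in a Banach algebra: a function of small norm may be substituted into a convergent power series,
and the result has comparable norm (\<open>bd_power_series\<close>). Thus the pointwise formulas turn into
norm estimates at once. The unit has norm \<open>4 \<pi>\<^sup>2 / 3\<close> rather than 1, and each
multiplication costs an absolute constant; this is absorbed by \<open>C \<ge> C\<^sub>0\<close> and accounts
for \<open>C\<^bsup>2n\<^esup>\<close> in place of \<open>C\<^bsup>n\<^esup>\<close>.

Multiplying \<open>n\<close> factors (\<open>svd_step\<close>, \<open>svd_iterate\<close>), the angle that enters a step is not \<open>\<theta>\<close> itself,
but \<open>\<theta>\<close> plus the displacement of the expanded direction produced by the preceding step. Let \<open>\<rho>\<close>
bound the norms of the reciprocals \<open>1/e l\<close>, and \<open>P\<close> those of \<open>1/cos \<theta>\<close> and \<open>tan \<theta>\<close>. Displacements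
are of order \<open>P \<rho>\<^sup>2\<close>, hence at most \<open>\<rho> / n\<close> if \<open>n P\<^sup>4 \<rho> \<le> 1\<close>; the perturbation of the angle is
then harmless, and \<open>n\<close> displacements of the contracted direction add up to at most \<open>\<rho>\<close>.

In the theorem \<open>\<rho>\<close> is \<open>C \<lambda>\<^bsup>-q/3\<^esup>\<close> with \<open>q = q\<^bsub>m-1\<^esub>\<close>. For \<open>\<alpha>\<close> of bounded type \<open>q\<^sub>m \<le> M q\<close>, so
\<open>P = C exp (q\<^sub>m\<^sup>\<gamma>)\<close> and \<open>n \<le> q\<^sub>m\<^sup>C + 1\<close> grow at most exponentially in \<open>q\<close>, and the smallness
condition holds once \<open>\<lambda>\<close> is large (\<open>scale_separation\<close>).
\<close>

section \<open>The Gevrey norm as a Banach algebra norm\<close>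

text \<open>The factor \<open>(1 + k)\<^sup>2\<close> and the constant \<open>4 \<pi>\<^sup>2 / 3\<close> in the Gevrey norm are chosen so that the
norm is submultiplicative. The weight below is the reciprocal of the coefficient of the
\<open>k\<close>-th derivative in that norm.\<close>

definition gevrey_weight :: "real \<Rightarrow> real \<Rightarrow> nat \<Rightarrow> real" where
  "gevrey_weight s K k = K ^ k * fact k powr s / (4 * pi\<^sup>2 / 3 * (1 + real k)\<^sup>2)"

text \<open>The assertion that \<open>f\<close> has Gevrey norm at most \<open>B\<close>, phrased through a whole sequence of
successive derivatives. Sums, products and series are then bounded by exhibiting their
derivatives, with no appeal to a derivative operator, and only the values of \<open>f\<close> on \<open>I\<close> enter.\<close>

definition gevrey_bd :: "real set \<Rightarrow> real \<Rightarrow> real \<Rightarrow> (real \<Rightarrow> real) \<Rightarrow> real \<Rightarrow> bool" where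
  "gevrey_bd I s K f B \<longleftrightarrow> (\<exists>F :: nat \<Rightarrow> real \<Rightarrow> real. (\<forall>x\<in>I. F 0 x = f x) \<and>
     (\<forall>k. \<forall>x\<in>I. (F k has_real_derivative F (Suc k) x) (at x within I) \<and>
        \<bar>F k x\<bar> \<le> B * gevrey_weight s K k))"

lemma gevrey_bd_cong: "gevrey_bd I s K f B \<Longrightarrow> (\<And>x. x \<in> I \<Longrightarrow> g x = f x) \<Longrightarrow> gevrey_bd I s K g B"
  unfolding gevrey_bd_def by auto

lemma gevrey_weight_pos: "0 < K \<Longrightarrow> 0 < gevrey_weight s K k"
  unfolding gevrey_weight_def by (intro divide_pos_pos mult_pos_pos) auto

lemma gevrey_bd_mono:
  assumes "gevrey_bd I s K f B" "B \<le> B'" "0 < K"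
  shows "gevrey_bd I s K f B'"
proof -
  from assms(1) obtain F where F: "\<forall>x\<in>I. F 0 x = f x"
    "\<And>k x. x \<in> I \<Longrightarrow> (F k has_real_derivative F (Suc k) x) (at x within I)"
    "\<And>k x. x \<in> I \<Longrightarrow> \<bar>F k x\<bar> \<le> B * gevrey_weight s K k"
    unfolding gevrey_bd_def by blast
  have "B * gevrey_weight s K k \<le> B' * gevrey_weight s K k" for k
    using assms gevrey_weight_pos[of K s k] by (intro mult_right_mono) auto
  hence "\<bar>F k x\<bar> \<le> B' * gevrey_weight s K k" if "x \<in> I" for k x
    using F(3)[OF that, of k] order_trans by blast
  with F(1,2) show ?thesis unfolding gevrey_bd_def by (intro exI[of _ F]) simp
qed

lemma gevrey_bd_mono_K:
  assumes "gevrey_bd I s K f B" "0 \<le> B" "0 < K" "K \<le> K'"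
  shows "gevrey_bd I s K' f B"
proof -
  from assms(1) obtain F where F: "\<forall>x\<in>I. F 0 x = f x"
    "\<And>k x. x \<in> I \<Longrightarrow> (F k has_real_derivative F (Suc k) x) (at x within I)"
    "\<And>k x. x \<in> I \<Longrightarrow> \<bar>F k x\<bar> \<le> B * gevrey_weight s K k"
    unfolding gevrey_bd_def by blast
  have "B * gevrey_weight s K k \<le> B * gevrey_weight s K' k" for k
    unfolding gevrey_weight_def using assms
    by (intro mult_left_mono divide_right_mono mult_right_mono power_mono) auto
  hence "\<bar>F k x\<bar> \<le> B * gevrey_weight s K' k" if "x \<in> I" for k x
    using F(3)[OF that, of k] order_trans by blast
  with F(1,2) show ?thesis unfolding gevrey_bd_def by (intro exI[of _ F]) simp
qed

text \<open>This is the inequality behind submultiplicativity. The factorials contribute at most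
\<open>k!\<^sup>s\<close> because \<open>binomial k j * (j! (k-j)!)\<^sup>s = k! * (j! (k-j)!)\<^sup>s\<^sup>-\<^sup>1\<close> and \<open>j! (k-j)! \<le> k!\<close>. For the
polynomial factors, \<open>a = 1 + j\<close> and \<open>b = 1 + k - j\<close> satisfy
\<open>(1+k)\<^sup>2 \<le> (a+b)\<^sup>2 \<le> 2 (a\<^sup>2 + b\<^sup>2)\<close>, so that the sum is at most
\<open>4 \<Sum> 1/(1+j)\<^sup>2 \<le> 2 \<pi>\<^sup>2 / 3\<close>.\<close>

lemma weighted_leibniz:
  assumes "1 \<le> s" "0 < K"
  shows "(\<Sum>j\<le>k. real (k choose j) * (gevrey_weight s K j * gevrey_weight s K (k - j)))
           \<le> gevrey_weight s K k"
proof -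
  define c where "c = 4 * pi\<^sup>2 / 3"
  have c: "c > 0" by (simp add: c_def)
  define w where "w j = 1 / (1 + real j)\<^sup>2" for j
  have W: "gevrey_weight s K j = K ^ j * fact j powr s * w j / c" for j
    by (simp add: gevrey_weight_def c_def w_def)
  have summand: "real (k choose j) * (gevrey_weight s K j * gevrey_weight s K (k - j))
      \<le> K ^ k * fact k powr s * w k / c\<^sup>2 * (2 * (w j + w (k - j)))" if "j \<le> k" for j
  proof -
    have fle: "fact j * fact (k - j) \<le> (fact k :: real)"
      using that binomial_fact_lemma[OF that] binomial_eq_0_iff[of k j]
      by (metis (mono_tags, opaque_lifting) dvd_imp_le fact_fact_dvd_fact fact_gt_zero le_add_diff_inverse of_nat_fact of_nat_le_iff of_nat_mult)
    have fpos: "fact j * fact (k - j) > (0::real)" by simp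
    have "real (k choose j) = fact k / (fact j * fact (k - j))"
      using binomial_fact[OF that, where 'a=real] by simp
    moreover have "fact j powr s * fact (k - j) powr s = (fact j * fact (k - j) :: real) powr s"
      by (simp add: powr_mult)
    moreover have "(fact j * fact (k - j) :: real) powr s
        = (fact j * fact (k - j)) * (fact j * fact (k - j) :: real) powr (s - 1)"
      using fpos by (simp add: powr_diff)
    ultimately have "real (k choose j) * (fact j powr s * fact (k - j) powr s)
        = fact k * (fact j * fact (k - j) :: real) powr (s - 1)"
      using fpos by (simp add: field_simps)
    also have "\<dots> \<le> fact k * (fact k :: real) powr (s - 1)"
      using fle assms by (intro mult_left_mono powr_mono2) auto
    also have "\<dots> = fact k powr s" by (simp add: powr_diff)
    finally have 1: "real (k choose j) * (fact j powr s * fact (k - j) powr s) \<le> fact k powr s" .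
    have 2: "w j * w (k - j) \<le> w k * (2 * (w j + w (k - j)))"
    proof -
      define a b where "a = 1 + real j" and "b = 1 + real (k - j)"
      have ab: "a > 0" "b > 0" by (simp_all add: a_def b_def)
      have k: "1 + real k = a + b - 1" using that by (simp add: a_def b_def of_nat_diff)
      have "(1 + real k)\<^sup>2 \<le> (a + b)\<^sup>2"
        unfolding k using ab by (intro power_mono) (auto simp: a_def b_def)
      also have "\<dots> \<le> 2 * (a\<^sup>2 + b\<^sup>2)"
        using sum_squares_bound[of a b] by (simp add: power2_sum)
      finally have "(1 + real k)\<^sup>2 \<le> 2 * (a\<^sup>2 + b\<^sup>2)" .
      hence "1 \<le> 1 / (1 + real k)\<^sup>2 * (2 * (a\<^sup>2 + b\<^sup>2))"
        by (simp add: field_simps)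
      hence "1 / a\<^sup>2 * (1 / b\<^sup>2) * 1 \<le> 1 / a\<^sup>2 * (1 / b\<^sup>2) * (1 / (1 + real k)\<^sup>2 * (2 * (a\<^sup>2 + b\<^sup>2)))"
        using ab by (intro mult_left_mono) auto
      also have "\<dots> = 1 / (1 + real k)\<^sup>2 * (2 * (1 / a\<^sup>2 + 1 / b\<^sup>2))"
        using ab by (simp add: field_simps)
      finally show ?thesis by (simp add: w_def a_def b_def)
    qed
    have "real (k choose j) * (gevrey_weight s K j * gevrey_weight s K (k - j))
        = K ^ k / c\<^sup>2 * ((real (k choose j) * (fact j powr s * fact (k - j) powr s)) * (w j * w (k - j)))"
      using that by (simp add: W power2_eq_square power_add[symmetric] mult_ac)
    also have "\<dots> \<le> K ^ k / c\<^sup>2 * (fact k powr s * (w k * (2 * (w j + w (k - j)))))"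
      using assms c by (intro mult_left_mono mult_mono[OF 1 2]) (auto simp: w_def)
    finally show ?thesis by (simp add: mult_ac)
  qed
  have wsum: "(\<Sum>j\<le>k. w j) \<le> pi\<^sup>2 / 6"
  proof -
    have "(\<lambda>n. w n) sums (pi\<^sup>2 / 6)"
      using inverse_squares_sums by (simp add: w_def add.commute)
    thus ?thesis
      by (metis sum_le_suminf sums_iff finite_atMost w_def zero_le_divide_1_iff zero_le_power2)
  qed
  have rev: "(\<Sum>j\<le>k. w (k - j)) = (\<Sum>j\<le>k. w j)"
    by (rule sum.nat_diff_reindex[of w "Suc k", unfolded lessThan_Suc_atMost, simplified])
  have "(\<Sum>j\<le>k. real (k choose j) * (gevrey_weight s K j * gevrey_weight s K (k - j)))
      \<le> (\<Sum>j\<le>k. K ^ k * fact k powr s * w k / c\<^sup>2 * (2 * (w j + w (k - j))))"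
    by (intro sum_mono summand) auto
  also have "\<dots> = K ^ k * fact k powr s * w k / c\<^sup>2 * (4 * (\<Sum>j\<le>k. w j))"
    unfolding sum_distrib_left[symmetric] sum.distrib rev by simp
  also have "\<dots> \<le> K ^ k * fact k powr s * w k / c\<^sup>2 * c"
  proof (rule mult_left_mono)
    show "4 * (\<Sum>j\<le>k. w j) \<le> c" using wsum zero_le_power2[of pi] unfolding c_def by linarith
  qed (use assms in \<open>auto simp: w_def\<close>)
  also have "\<dots> = gevrey_weight s K k" using c by (simp add: W power2_eq_square)
  finally show ?thesis .
qed

text \<open>A nondegenerate interval has no isolated points, which is what makes derivatives within \<open>I\<close>
unique, including at an endpoint.\<close>

locale gevrey_interval =
  fixes I :: "real set" and s K :: real
  assumes interval: "is_interval I" and nondegenerate: "interior I \<noteq> {}"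
    and s_ge_1: "1 \<le> s" and K_pos: "0 < K"
begin

lemma I_nonempty: "I \<noteq> {}"
  using nondegenerate interior_subset by blast

lemma at_within_I_nontrivial: "x \<in> I \<Longrightarrow> at x within I \<noteq> bot"
proof -
  assume x: "x \<in> I"
  have "I \<noteq> {x}" using nondegenerate by auto
  hence "x islimpt I" 
    using connected_imp_perfect[of I x] is_interval_connected[OF interval] x by auto
  thus ?thesis by (simp add: trivial_limit_within)
qed

lemma deriv_on_eqI:
  assumes "\<And>x. x \<in> I \<Longrightarrow> F 0 x = f x"
    and "\<And>k x. x \<in> I \<Longrightarrow> (F k has_real_derivative F (Suc k) x) (at x within I)"
    and "x \<in> I"
  shows "deriv_on I k f x = F k x"
  using assms(3)
proof (induction k arbitrary: x)
  case 0
  then show ?case using assms(1) by (simp add: deriv_on_def)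
next
  case (Suc k)
  have "(deriv_on I k f has_real_derivative F (Suc k) x) (at x within I)"
    using assms(2)[OF Suc.prems, of k] Suc.prems Suc.IH
    by (subst has_field_derivative_cong_ev) (auto simp: eventually_at_filter intro: has_field_derivative_transform_within)
  hence "vector_derivative (deriv_on I k f) (at x within I) = F (Suc k) x"
    using at_within_I_nontrivial[OF Suc.prems]
    by (intro vector_derivative_within) (auto simp: has_real_derivative_iff_has_vector_derivative)
  thus ?case by (simp add: deriv_on_def)
qed

lemma gevrey_norm_le_iff:
  assumes "0 \<le> B"
  shows "gevrey_norm I s K f \<le> ennreal B \<longleftrightarrow> gevrey_bd I s K f B"
proof -
  have w: "ennreal (4 * pi\<^sup>2 / 3) * (ennreal ((1 + real k)\<^sup>2 / (K ^ k * fact k powr s)) * ennreal \<bar>d\<bar>)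
       \<le> ennreal B \<longleftrightarrow> \<bar>d\<bar> \<le> B * gevrey_weight s K k" for k d
  proof -
    have "ennreal (4 * pi\<^sup>2 / 3) * (ennreal ((1 + real k)\<^sup>2 / (K ^ k * fact k powr s)) * ennreal \<bar>d\<bar>)
        = ennreal (4 * pi\<^sup>2 / 3 * ((1 + real k)\<^sup>2 / (K ^ k * fact k powr s) * \<bar>d\<bar>))"
      using K_pos by (subst ennreal_mult[symmetric]; simp)+
    also have "4 * pi\<^sup>2 / 3 * ((1 + real k)\<^sup>2 / (K ^ k * fact k powr s) * \<bar>d\<bar>) = \<bar>d\<bar> / gevrey_weight s K k"
      by (simp add: gevrey_weight_def mult_ac)
    finally show ?thesis
      using gevrey_weight_pos[OF K_pos, of s k] assms
      by (simp add: pos_divide_le_eq)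
  qed
  have *: "gevrey_norm I s K f \<le> ennreal B \<longleftrightarrow>
        smooth_fun_on I f \<and> (\<forall>k. \<forall>x\<in>I. \<bar>deriv_on I k f x\<bar> \<le> B * gevrey_weight s K k)"
    by (simp add: gevrey_norm_def SUP_mult_left_ennreal SUP_le_iff w)
       (auto simp: top_unique)
  show ?thesis
  proof
    assume "gevrey_norm I s K f \<le> ennreal B"
    hence sm: "smooth_fun_on I f" and b: "\<And>k x. x \<in> I \<Longrightarrow> \<bar>deriv_on I k f x\<bar> \<le> B * gevrey_weight s K k"
      by (auto simp: *)
    have "(deriv_on I k f has_real_derivative deriv_on I (Suc k) f x) (at x within I)" if "x \<in> I" for k x
      using sm that vector_derivative_works[of "deriv_on I k f" "at x within I"]
      by (simp add: smooth_fun_on_def has_real_derivative_iff_has_vector_derivative deriv_on_def)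
    thus "gevrey_bd I s K f B"
      unfolding gevrey_bd_def using b
      by (intro exI[of _ "\<lambda>k. deriv_on I k f"]) (auto simp: deriv_on_def)
  next
    assume "gevrey_bd I s K f B"
    then obtain F where F: "\<And>x. x \<in> I \<Longrightarrow> F 0 x = f x"
      "\<And>k x. x \<in> I \<Longrightarrow> (F k has_real_derivative F (Suc k) x) (at x within I)"
      "\<And>k x. x \<in> I \<Longrightarrow> \<bar>F k x\<bar> \<le> B * gevrey_weight s K k"
      unfolding gevrey_bd_def by blast
    have eq: "deriv_on I k f x = F k x" if "x \<in> I" for k x
      using deriv_on_eqI[of F f, OF F(1,2) that] by blast
    have "deriv_on I k f differentiable (at x within I)" if "x \<in> I" for k x
    proof -
      have "(deriv_on I k f has_real_derivative F (Suc k) x) (at x within I)"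
        using has_field_derivative_transform_within[OF F(2)[OF that, of k], of 1 "deriv_on I k f"] that eq by simp
      thus ?thesis using real_differentiable_def by blast
    qed
    thus "gevrey_norm I s K f \<le> ennreal B"
      by (auto simp: * smooth_fun_on_def eq F(3))
  qed
qed

definition bd :: "(real \<Rightarrow> real) \<Rightarrow> real \<Rightarrow> bool" where "bd = gevrey_bd I s K"

lemma bdE:
  assumes "bd f B"
  obtains F where "\<And>x. x \<in> I \<Longrightarrow> F 0 x = f x"
      "\<And>k x. x \<in> I \<Longrightarrow> (F k has_real_derivative F (Suc k) x) (at x within I)"
      "\<And>k x. x \<in> I \<Longrightarrow> \<bar>F k x\<bar> \<le> B * gevrey_weight s K k"
  using assms unfolding bd_def gevrey_bd_def by blast

lemma bdI:
  assumes "\<And>x. x \<in> I \<Longrightarrow> F 0 x = f x"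
      "\<And>k x. x \<in> I \<Longrightarrow> (F k has_real_derivative F (Suc k) x) (at x within I)"
      "\<And>k x. x \<in> I \<Longrightarrow> \<bar>F k x\<bar> \<le> B * gevrey_weight s K k"
  shows "bd f B"
  using assms unfolding bd_def gevrey_bd_def by blast

lemma bd_cong: "bd f B \<Longrightarrow> (\<And>x. x \<in> I \<Longrightarrow> g x = f x) \<Longrightarrow> bd g B"
  unfolding bd_def by (rule gevrey_bd_cong)

lemma bd_mono: "bd f B \<Longrightarrow> B \<le> B' \<Longrightarrow> bd f B'"
  unfolding bd_def by (rule gevrey_bd_mono[OF _ _ K_pos])

lemma bd_cong_mono: "bd f B \<Longrightarrow> (\<And>x. x \<in> I \<Longrightarrow> g x = f x) \<Longrightarrow> B \<le> B' \<Longrightarrow> bd g B'"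
  by (rule bd_mono[OF bd_cong])

lemma weight_pos: "0 < gevrey_weight s K k"
  by (rule gevrey_weight_pos[OF K_pos])

text \<open>The derivative of order 0 has coefficient \<open>4 \<pi>\<^sup>2 / 3 \<ge> 4\<close>, so the norm controls the supremum.\<close>

lemma bd_abs_le:
  assumes "bd f B" "x \<in> I"
  shows "\<bar>f x\<bar> \<le> B / 4"
proof -
  from assms(1) obtain F where F: "\<And>x. x \<in> I \<Longrightarrow> F 0 x = f x"
      "\<And>k x. x \<in> I \<Longrightarrow> (F k has_real_derivative F (Suc k) x) (at x within I)"
      "\<And>k x. x \<in> I \<Longrightarrow> \<bar>F k x\<bar> \<le> B * gevrey_weight s K k"
    by (rule bdE) blast
  from F(1)[OF assms(2)] F(3)[OF assms(2), of 0]
  have *: "\<bar>f x\<bar> \<le> B / (4 * pi\<^sup>2 / 3)" by (simp add: gevrey_weight_def)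
  have B: "B \<ge> 0"
  proof (rule ccontr)
    assume "\<not> B \<ge> 0"
    hence "B / (4 * pi\<^sup>2 / 3) < 0" by (intro divide_neg_pos) auto
    with * show False by simp
  qed
  have "(3::real)\<^sup>2 < pi\<^sup>2" using pi_gt3 by (intro power_strict_mono) auto
  with B have "B / (4 * pi\<^sup>2 / 3) \<le> B / 4" by (intro divide_left_mono) auto
  with * show ?thesis by simp
qed

lemma bd_nonneg:
  assumes "bd f B"
  shows "0 \<le> B"
proof -
  obtain x where "x \<in> I" using I_nonempty by blast
  from bd_abs_le[OF assms this] show ?thesis by linarith
qed

lemma bd_continuous_on: "bd f B \<Longrightarrow> continuous_on I f"
proof -
  assume "bd f B"
  then obtain F where F: "\<And>x. x \<in> I \<Longrightarrow> F 0 x = f x"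
      "\<And>k x. x \<in> I \<Longrightarrow> (F k has_real_derivative F (Suc k) x) (at x within I)"
      "\<And>k x. x \<in> I \<Longrightarrow> \<bar>F k x\<bar> \<le> B * gevrey_weight s K k"
    by (rule bdE) blast
  have "continuous_on I (F 0)"
    using F(2) DERIV_continuous continuous_on_eq_continuous_within by blast
  thus ?thesis using F(1) by (simp cong: continuous_on_cong)
qed

text \<open>The constant function 1 has norm \<open>4 \<pi>\<^sup>2 / 3\<close>, which is at most 22 since \<open>\<pi> < 4\<close>.\<close>

lemma bd_const: "bd (\<lambda>x. c) (22 * \<bar>c\<bar>)"
proof (rule bd_mono)
  show "bd (\<lambda>x. c) (4 * pi\<^sup>2 / 3 * \<bar>c\<bar>)"
  proof (rule bdI[of "\<lambda>k x. if k = 0 then c else 0"])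
    show "\<bar>if k = 0 then c else 0\<bar> \<le> 4 * pi\<^sup>2 / 3 * \<bar>c\<bar> * gevrey_weight s K k" for k
      using weight_pos[of k] by (cases "k = 0") (auto simp: gevrey_weight_def[of _ _ 0])
  qed auto
  have "pi\<^sup>2 \<le> 4\<^sup>2" using pi_less_4 by (intro power_mono) auto
  thus "4 * pi\<^sup>2 / 3 * \<bar>c\<bar> \<le> 22 * \<bar>c\<bar>" by (intro mult_right_mono) auto
qed

lemma bd_one: "bd (\<lambda>x. 1) 22"
  using bd_const[of 1] by simp

lemma bd_zero: "0 \<le> B \<Longrightarrow> bd (\<lambda>x. 0) B"
  using bd_const[of 0] bd_mono by simp

lemma bd_add:
  assumes "bd f A" "bd g B"
  shows "bd (\<lambda>x. f x + g x) (A + B)"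
proof -
  from assms(1) obtain F where F: "\<And>x. x \<in> I \<Longrightarrow> F 0 x = f x"
      "\<And>k x. x \<in> I \<Longrightarrow> (F k has_real_derivative F (Suc k) x) (at x within I)"
      "\<And>k x. x \<in> I \<Longrightarrow> \<bar>F k x\<bar> \<le> A * gevrey_weight s K k"
    by (rule bdE) blast
  from assms(2) obtain G where G: "\<And>x. x \<in> I \<Longrightarrow> G 0 x = g x"
      "\<And>k x. x \<in> I \<Longrightarrow> (G k has_real_derivative G (Suc k) x) (at x within I)"
      "\<And>k x. x \<in> I \<Longrightarrow> \<bar>G k x\<bar> \<le> B * gevrey_weight s K k"
    by (rule bdE) blast
  show ?thesis
  proof (rule bdI[of "\<lambda>k x. F k x + G k x"])
    show "\<bar>F k x + G k x\<bar> \<le> (A + B) * gevrey_weight s K k" if "x \<in> I" for k x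
      using F(3)[OF that, of k] G(3)[OF that, of k] by (simp add: distrib_right)
  qed (use F G in \<open>auto intro!: derivative_intros\<close>)
qed

lemma bd_cmult:
  assumes "bd f A"
  shows "bd (\<lambda>x. c * f x) (\<bar>c\<bar> * A)"
proof -
  from assms(1) obtain F where F: "\<And>x. x \<in> I \<Longrightarrow> F 0 x = f x"
      "\<And>k x. x \<in> I \<Longrightarrow> (F k has_real_derivative F (Suc k) x) (at x within I)"
      "\<And>k x. x \<in> I \<Longrightarrow> \<bar>F k x\<bar> \<le> A * gevrey_weight s K k"
    by (rule bdE) blast
  show ?thesis
  proof (rule bdI[of "\<lambda>k x. c * F k x"])
    show "\<bar>c * F k x\<bar> \<le> \<bar>c\<bar> * A * gevrey_weight s K k" if "x \<in> I" for k x
      using mult_left_mono[OF F(3)[OF that, of k], of "\<bar>c\<bar>"] by (simp add: abs_mult mult_ac)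
    show "((\<lambda>x. c * F k x) has_real_derivative c * F (Suc k) x) (at x within I)" if "x \<in> I" for k x
      using F(2)[OF that, of k] by (auto intro!: derivative_eq_intros)
  qed (use F in auto)
qed

lemma bd_minus: "bd f A \<Longrightarrow> bd (\<lambda>x. - f x) A"
  using bd_cmult[of f A "-1"] by simp

lemma bd_diff: "bd f A \<Longrightarrow> bd g B \<Longrightarrow> bd (\<lambda>x. f x - g x) (A + B)"
  using bd_add[OF _ bd_minus, of f A g B] by simp

text \<open>Pascal's rule: the derivative of the \<open>k\<close>-th Leibniz sum is the next one.\<close>

lemma leibniz_step:
  fixes f g :: "nat \<Rightarrow> real"
  shows "(\<Sum>j\<le>k. real (k choose j) * (f (Suc j) * g (k - j) + f j * g (Suc (k - j))))
       = (\<Sum>j\<le>Suc k. real (Suc k choose j) * (f j * g (Suc k - j)))"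
proof -
  have "(\<Sum>j\<le>Suc k. real (Suc k choose j) * (f j * g (Suc k - j)))
      = f 0 * g (Suc k) + (\<Sum>j\<le>k. real (Suc k choose Suc j) * (f (Suc j) * g (k - j)))"
    by (subst sum.atMost_Suc_shift) simp
  also have "\<dots> = (\<Sum>j\<le>k. real (k choose j) * (f (Suc j) * g (k - j)))
      + (f 0 * g (Suc k) + (\<Sum>j\<le>k. real (k choose Suc j) * (f (Suc j) * g (k - j))))"
    by (simp add: distrib_right sum.distrib)
  also have "f 0 * g (Suc k) + (\<Sum>j\<le>k. real (k choose Suc j) * (f (Suc j) * g (k - j)))
      = (\<Sum>j\<le>Suc k. real (k choose j) * (f j * g (Suc k - j)))"
    by (subst sum.atMost_Suc_shift[of "\<lambda>j. real (k choose j) * (f j * g (Suc k - j))"]) simp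
  also have "\<dots> = (\<Sum>j\<le>k. real (k choose j) * (f j * g (Suc (k - j))))"
    by (simp add: Suc_diff_le)
  finally show ?thesis by (simp add: distrib_left sum.distrib)
qed

lemma bd_mult:
  assumes "bd f A" "bd g B"
  shows "bd (\<lambda>x. f x * g x) (A * B)"
proof -
  from assms(1) obtain F where F: "\<And>x. x \<in> I \<Longrightarrow> F 0 x = f x"
      "\<And>k x. x \<in> I \<Longrightarrow> (F k has_real_derivative F (Suc k) x) (at x within I)"
      "\<And>k x. x \<in> I \<Longrightarrow> \<bar>F k x\<bar> \<le> A * gevrey_weight s K k"
    by (rule bdE) blast
  from assms(2) obtain G where G: "\<And>x. x \<in> I \<Longrightarrow> G 0 x = g x"
      "\<And>k x. x \<in> I \<Longrightarrow> (G k has_real_derivative G (Suc k) x) (at x within I)"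
      "\<And>k x. x \<in> I \<Longrightarrow> \<bar>G k x\<bar> \<le> B * gevrey_weight s K k"
    by (rule bdE) blast
  define H where "H k x = (\<Sum>j\<le>k. real (k choose j) * (F j x * G (k - j) x))" for k x
  show ?thesis
  proof (rule bdI[of H])
    show "H 0 x = f x * g x" if "x \<in> I" for x using F(1) G(1) that by (simp add: H_def)
  next
    fix k x assume x: "x \<in> I"
    have "(H k has_real_derivative
        (\<Sum>j\<le>k. real (k choose j) * (F (Suc j) x * G (k - j) x + F j x * G (Suc (k - j)) x))) (at x within I)"
      unfolding H_def
    proof (rule DERIV_sum)
      fix j
      show "((\<lambda>x. real (k choose j) * (F j x * G (k - j) x)) has_real_derivative
          real (k choose j) * (F (Suc j) x * G (k - j) x + F j x * G (Suc (k - j)) x)) (at x within I)"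
        using F(2)[OF x, of j] G(2)[OF x, of "k - j"]
        by (auto intro!: derivative_eq_intros simp: algebra_simps)
    qed
    thus "(H k has_real_derivative H (Suc k) x) (at x within I)"
      unfolding leibniz_step[where f = "\<lambda>j. F j x" and g = "\<lambda>j. G j x"] by (simp only: H_def)
    have A0: "0 \<le> A" "0 \<le> B" using assms bd_nonneg by auto
    have "\<bar>H k x\<bar> \<le> (\<Sum>j\<le>k. \<bar>real (k choose j) * (F j x * G (k - j) x)\<bar>)"
      unfolding H_def by (rule sum_abs)
    also have "\<dots> \<le> (\<Sum>j\<le>k. real (k choose j) * ((A * gevrey_weight s K j) * (B * gevrey_weight s K (k - j))))"
    proof (rule sum_mono)
      fix j
      have "\<bar>F j x\<bar> * \<bar>G (k - j) x\<bar> \<le> (A * gevrey_weight s K j) * (B * gevrey_weight s K (k - j))"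
        using F(3)[OF x, of j] G(3)[OF x, of "k - j"] A0 weight_pos[of j]
        by (intro mult_mono) auto
      thus "\<bar>real (k choose j) * (F j x * G (k - j) x)\<bar>
        \<le> real (k choose j) * ((A * gevrey_weight s K j) * (B * gevrey_weight s K (k - j)))"
        by (simp add: abs_mult mult_left_mono)
    qed
    also have "\<dots> = A * B * (\<Sum>j\<le>k. real (k choose j) * (gevrey_weight s K j * gevrey_weight s K (k - j)))"
      by (simp add: sum_distrib_left mult_ac)
    also have "\<dots> \<le> A * B * gevrey_weight s K k"
      using weighted_leibniz[OF s_ge_1 K_pos] A0 by (intro mult_left_mono) auto
    finally show "\<bar>H k x\<bar> \<le> A * B * gevrey_weight s K k" .
  qed
qed

lemma bd_power_Suc: "bd f A \<Longrightarrow> bd (\<lambda>x. f x ^ Suc n) (A ^ Suc n)"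
proof (induction n)
  case 0
  then show ?case by simp
next
  case (Suc n)
  then show ?case using bd_mult[OF Suc.prems Suc.IH[OF Suc.prems]] by simp
qed

text \<open>Norm-summable series may be differentiated term by term, as the derivatives of each order
converge uniformly by the Weierstrass test. Hence the Gevrey functions are complete for
this norm.\<close>

lemma bd_sums:
  assumes f: "\<And>n. bd (f n) (B n)" and sB: "B sums S"
    and g: "\<And>x. x \<in> I \<Longrightarrow> (\<lambda>n. f n x) sums g x"
  shows "bd g S"
proof -
  have "\<forall>n. \<exists>F. (\<forall>x\<in>I. F 0 x = f n x) \<and>
     (\<forall>k. \<forall>x\<in>I. (F k has_real_derivative F (Suc k) x) (at x within I) \<and>
        \<bar>F k x\<bar> \<le> B n * gevrey_weight s K k)"
    using f unfolding bd_def gevrey_bd_def by simp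
  from choice[OF this] obtain F where "\<forall>n. (\<forall>x\<in>I. F n 0 x = f n x) \<and>
     (\<forall>k. \<forall>x\<in>I. (F n k has_real_derivative F n (Suc k) x) (at x within I) \<and>
        \<bar>F n k x\<bar> \<le> B n * gevrey_weight s K k)" ..
  hence F: "\<And>n x. x \<in> I \<Longrightarrow> F n 0 x = f n x"
      "\<And>n k x. x \<in> I \<Longrightarrow> (F n k has_real_derivative F n (Suc k) x) (at x within I)"
      "\<And>n k x. x \<in> I \<Longrightarrow> \<bar>F n k x\<bar> \<le> B n * gevrey_weight s K k" by simp_all
  have sBw: "(\<lambda>n. B n * gevrey_weight s K k) sums (S * gevrey_weight s K k)" for k
    by (rule sums_mult2[OF sB])
  have sF: "summable (\<lambda>n. \<bar>F n k x\<bar>)" if "x \<in> I" for k x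
    by (rule summable_comparison_test'[OF sums_summable[OF sBw[of k]], of 0]) (use F(3)[OF that] in auto)
  have sF': "summable (\<lambda>n. F n k x)" if "x \<in> I" for k x
    by (rule summable_rabs_cancel[OF sF[OF that]])
  define G where "G k x = (\<Sum>n. F n k x)" for k x
  show ?thesis
  proof (rule bdI[of G])
    show "G 0 x = g x" if "x \<in> I" for x
      using g[OF that] F(1)[OF that] by (simp add: G_def sums_iff)
  next
    fix k x assume x: "x \<in> I"
    have ul: "uniform_limit I (\<lambda>n x. \<Sum>i<n. F i (Suc k) x) (G (Suc k)) sequentially"
      unfolding G_def
      by (rule Weierstrass_m_test[OF _ sums_summable[OF sBw[of "Suc k"]]]) (use F(3) in auto)
    from has_field_derivative_series[OF is_interval_convex[OF interval] F(2) ul x sF'[OF x]]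
    obtain h where h: "\<And>y. y \<in> I \<Longrightarrow> (\<lambda>n. F n k y) sums h y"
      "\<And>y. y \<in> I \<Longrightarrow> (h has_field_derivative G (Suc k) y) (at y within I)" by blast
    have "h y = G k y" if "y \<in> I" for y using h(1)[OF that] by (simp add: G_def sums_iff)
    thus "(G k has_real_derivative G (Suc k) x) (at x within I)"
      using has_field_derivative_transform_within[OF h(2)[OF x], of 1 "G k"] x by simp
    have "\<bar>G k x\<bar> \<le> (\<Sum>n. \<bar>F n k x\<bar>)" unfolding G_def using sF[OF x] by (rule summable_rabs)
    also have "\<dots> \<le> (\<Sum>n. B n * gevrey_weight s K k)"
      using F(3)[OF x] sF[OF x] sums_summable[OF sBw] by (intro suminf_le) auto
    also have "\<dots> = S * gevrey_weight s K k" using sBw by (simp add: sums_iff)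
    finally show "\<bar>G k x\<bar> \<le> S * gevrey_weight s K k" .
  qed
qed

text \<open>Substitution of a small function into a power series without constant term and with
coefficients bounded by 1. The exponents are a function of the summation index in order to
cover series such as those of \<open>sin\<close> and \<open>arctan\<close>, in which powers are missing.\<close>

lemma bd_power_series:
  assumes f: "bd f A" and A: "A \<le> 1 / 2"
    and c: "\<And>n. \<bar>c n\<bar> \<le> 1" and e: "\<And>n. Suc n \<le> e n"
    and g: "\<And>x. x \<in> I \<Longrightarrow> (\<lambda>n. c n * f x ^ e n) sums g x"
  shows "bd g (2 * A)"
proof (rule bd_sums[OF _ _ g])
  have A0: "0 \<le> A" by (rule bd_nonneg[OF f])
  show "(\<lambda>n. A * (1 / 2) ^ n) sums (2 * A)"
    using sums_mult[OF power_half_series, of "2 * A"] by simp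
  fix n
  obtain m where m: "e n = Suc m" using e[of n] by (cases "e n") auto
  hence nm: "n \<le> m" using e[of n] by simp
  have "\<bar>c n\<bar> * A ^ e n \<le> 1 * A ^ e n" using c A0 by (intro mult_right_mono) auto
  also have "\<dots> = A * A ^ m" by (simp add: m)
  also have "\<dots> \<le> A * (1 / 2) ^ m" using A A0 by (intro mult_left_mono power_mono) auto
  also have "\<dots> \<le> A * (1 / 2) ^ n" using A0 nm by (intro mult_left_mono power_decreasing) auto
  finally show "bd (\<lambda>x. c n * f x ^ e n) (A * (1 / 2) ^ n)"
    using bd_mono[OF bd_cmult[OF bd_power_Suc[OF f, of m], of "c n"]] by (simp add: m)
qed

lemma bd_small_abs: "bd f A \<Longrightarrow> A \<le> 1 / 2 \<Longrightarrow> x \<in> I \<Longrightarrow> \<bar>f x\<bar> \<le> 1 / 8"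
  using bd_abs_le[of f A x] by simp

lemma abs_gchoose_le_1:
  fixes p :: real
  assumes "\<bar>p\<bar> \<le> 1"
  shows "\<bar>p gchoose n\<bar> \<le> 1"
proof (induction n)
  case (Suc n)
  have "p gchoose Suc n = (p gchoose n) * ((p - real n) / (real n + 1))"
    using gbinomial_mult_1[of p n] by (simp add: field_simps)
  hence "\<bar>p gchoose Suc n\<bar> = \<bar>p gchoose n\<bar> * \<bar>(p - real n) / (real n + 1)\<bar>"
    by (simp only: abs_mult)
  also have "\<dots> \<le> 1 * 1"
    using Suc assms by (intro mult_mono) (auto simp: field_simps)
  finally show ?case by simp
qed auto

lemma bd_powr:
  assumes f: "bd f A" and A: "A \<le> 1 / 2" and p: "\<bar>p\<bar> \<le> 1"
  shows "bd (\<lambda>x. (1 + f x) powr p - 1) (2 * A)"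
proof (rule bd_power_series[OF f A, of "\<lambda>n. p gchoose Suc n" Suc])
  fix x assume "x \<in> I"
  hence "\<bar>f x\<bar> < 1" using bd_small_abs[OF f A] by fastforce
  thus "(\<lambda>n. (p gchoose Suc n) * f x ^ Suc n) sums ((1 + f x) powr p - 1)"
    by (subst sums_Suc_iff) (use gen_binomial_real[of "f x" p] in simp)
qed (use abs_gchoose_le_1[OF p] in auto)

lemma bd_inverse:
  assumes f: "bd f A" and A: "A \<le> 1 / 2"
  shows "bd (\<lambda>x. inverse (1 + f x)) 23"
proof -
  have "bd (\<lambda>x. ((1 + f x) powr - 1 - 1) + 1) (2 * A + 22)"
    by (intro bd_add bd_powr f A bd_one) auto
  hence "bd (\<lambda>x. ((1 + f x) powr - 1 - 1) + 1) 23" by (rule bd_mono) (use A in simp)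
  thus ?thesis
  proof (rule bd_cong)
    fix x assume "x \<in> I"
    hence "\<bar>f x\<bar> < 1" using bd_small_abs[OF f A] by fastforce
    hence "1 + f x > 0" by simp
    thus "inverse (1 + f x) = ((1 + f x) powr - 1 - 1) + 1" by (simp add: powr_minus)
  qed
qed

lemma bd_sqrt:
  assumes f: "bd f A" and A: "A \<le> 1 / 2"
  shows "bd (\<lambda>x. sqrt (1 + f x) - 1) (2 * A)"
  using bd_powr[OF assms, of "1 / 2"]
proof (rule bd_cong)
  fix x assume "x \<in> I"
  hence "\<bar>f x\<bar> < 1" using bd_small_abs[OF f A] by fastforce
  thus "sqrt (1 + f x) - 1 = (1 + f x) powr (1 / 2) - 1" by (simp add: powr_half_sqrt)
qed auto

lemma bd_arctan:
  assumes f: "bd f A" and A: "A \<le> 1 / 2"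
  shows "bd (\<lambda>x. arctan (f x)) (2 * A)"
proof (rule bd_power_series[OF f A, of "\<lambda>n. (-1) ^ n / real (n * 2 + 1)" "\<lambda>n. n * 2 + 1"])
  fix x assume "x \<in> I"
  hence "\<bar>f x\<bar> \<le> 1" using bd_small_abs[OF f A] by fastforce
  thus "(\<lambda>n. (-1) ^ n / real (n * 2 + 1) * f x ^ (n * 2 + 1)) sums arctan (f x)"
    using summable_arctan_series[of "f x"] by (simp add: sums_iff arctan_series)
qed (auto simp: power_abs abs_mult)

lemma bd_sin:
  assumes f: "bd f A" and A: "A \<le> 1 / 2"
  shows "bd (\<lambda>x. sin (f x)) (2 * A)"
proof (rule bd_power_series[OF f A _ _ sin_paired])
  show "\<bar>(-1) ^ n / fact (2 * n + 1)\<bar> \<le> (1::real)" for n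
    unfolding abs_divide power_abs by (simp del: fact_Suc add: fact_ge_1)
qed auto

lemma bd_cos:
  assumes f: "bd f A" and A: "A \<le> 1 / 2"
  shows "bd (\<lambda>x. cos (f x) - 1) (2 * A)"
proof (rule bd_power_series[OF f A, of "\<lambda>n. (-1) ^ Suc n / fact (2 * Suc n)" "\<lambda>n. 2 * Suc n"])
  fix x
  show "(\<lambda>n. (-1) ^ Suc n / fact (2 * Suc n) * f x ^ (2 * Suc n)) sums (cos (f x) - 1)"
    using cos_paired[of "f x"] sums_Suc_iff[of "\<lambda>n. (-1) ^ n / fact (2 * n) * f x ^ (2 * n)" "cos (f x) - 1"] by simp
next
  show "\<bar>(-1) ^ Suc n / fact (2 * Suc n)\<bar> \<le> (1::real)" for n
    unfolding abs_divide power_abs by (simp del: fact_Suc add: fact_ge_1)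
qed auto

text \<open>A continuous function without zeros has constant sign on an interval, so its absolute value
is the function or its negative.\<close>

lemma bd_abs:
  assumes f: "bd f A" and nz: "\<And>x. x \<in> I \<Longrightarrow> f x \<noteq> 0"
  shows "bd (\<lambda>x. \<bar>f x\<bar>) A"
proof -
  have conn: "connected (f ` I)"
    by (rule connected_continuous_image[OF bd_continuous_on[OF f] is_interval_connected[OF interval]])
  have "(\<forall>x\<in>I. f x > 0) \<or> (\<forall>x\<in>I. f x < 0)"
  proof (rule ccontr)
    assume "\<not> ?thesis"
    then obtain x y where xy: "x \<in> I" "y \<in> I" "f x < 0" "f y > 0"
      using nz by (metis linorder_neqE_linordered_idom)
    hence "0 \<in> f ` I" using connectedD_interval[OF conn, of "f x" "f y" 0] by auto
    thus False using nz by auto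
  qed
  thus ?thesis
  proof
    assume "\<forall>x\<in>I. f x > 0"
    thus ?thesis using bd_cong[OF f] by (metis abs_of_pos)
  next
    assume "\<forall>x\<in>I. f x < 0"
    thus ?thesis using bd_cong[OF bd_minus[OF f]] by (metis abs_of_neg)
  qed
qed

end

section \<open>Singular value decompositions in dimension two\<close>

definition rot :: "real \<Rightarrow> real^2^2" where
  "rot t = vector [vector [cos t, - sin t], vector [sin t, cos t]]"

definition dil :: "real \<Rightarrow> real^2^2" where
  "dil a = vector [vector [a, 0], vector [0, inverse a]]"

text \<open>A singular value decomposition up to sign, normalised so that \<open>s\<close> is the most contracted
direction of \<open>A\<close> and \<open>u\<close> the direction of the image of the most expanded one: the rotation
by \<open>\<pi>/2 - s\<close> takes the contracted direction to the second coordinate axis.\<close>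

definition has_svd :: "real^2^2 \<Rightarrow> real \<Rightarrow> real \<Rightarrow> real \<Rightarrow> bool" where
  "has_svd A a s u \<longleftrightarrow> (\<exists>\<sigma>\<in>{1, -1}. A = \<sigma> *\<^sub>R (rot u ** dil a ** rot (pi / 2 - s)))"

lemmas mat2_simps = vec_eq_iff forall_2 sum_2 matrix_matrix_mult_def matrix_vector_mult_def vector_2

lemma rot_add: "rot a ** rot b = rot (a + b)"
  by (simp add: rot_def mat2_simps cos_add sin_add algebra_simps)

lemma rot_add': "rot a ** (rot b ** C) = rot (a + b) ** C"
  by (simp add: rot_add matrix_mul_assoc)

lemma rot_int_pi: "\<exists>\<sigma>\<in>{1, -1}. rot (t + of_int k * pi) = \<sigma> *\<^sub>R rot t"
proof -
  have "cos (of_int k * pi) = (if even k then 1 else -1)" "sin (of_int k * pi) = 0"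
    using cos_npi_int[of k] sin_npi_int[of k] by (simp_all add: mult.commute)
  thus ?thesis
    by (intro bexI[of _ "if even k then 1 else -1"])
       (simp_all add: rot_def mat2_simps cos_add sin_add)
qed

lemma scaleR_matrix_mult:
  fixes A B :: "real^2^2"
  shows "(c *\<^sub>R A) ** B = c *\<^sub>R (A ** B)" "A ** (c *\<^sub>R B) = c *\<^sub>R (A ** B)"
  by (simp_all add: mat2_simps algebra_simps)

lemma rot_vec: "rot a *v vector [cos t, sin t] = vector [cos (a + t), sin (a + t)]"
  by (simp add: rot_def mat2_simps cos_add sin_add algebra_simps)

lemma norm_vec2: "norm (v :: real^2) = sqrt ((v $ 1)\<^sup>2 + (v $ 2)\<^sup>2)"
  by (simp add: norm_vec_def L2_set_def sum_2)

lemma norm_rot_vec: "norm (rot a *v v) = norm v"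
proof -
  have "(cos a * v$1 - sin a * v$2)\<^sup>2 + (sin a * v$1 + cos a * v$2)\<^sup>2
     = ((sin a)\<^sup>2 + (cos a)\<^sup>2) * ((v$1)\<^sup>2 + (v$2)\<^sup>2)"
    unfolding power2_eq_square by algebra
  thus ?thesis by (simp add: norm_vec2 rot_def mat2_simps)
qed

lemma has_svd_norm:
  assumes "has_svd A a s u"
  shows "norm (A *v v) = norm (dil a *v (rot (pi / 2 - s) *v v))"
proof -
  from assms obtain \<sigma> where \<sigma>: "\<sigma> \<in> {1, -1 :: real}" and A: "A = \<sigma> *\<^sub>R (rot u ** dil a ** rot (pi / 2 - s))"
    unfolding has_svd_def by blast
  have "A *v v = \<sigma> *\<^sub>R (rot u *v (dil a *v (rot (pi / 2 - s) *v v)))"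
    unfolding A by (simp add: matrix_vector_mul_assoc scaleR_matrix_vector_assoc matrix_mul_assoc)
  thus ?thesis using \<sigma> by (auto simp: norm_rot_vec)
qed

lemma dil_unit: "norm (dil a *v vector [cos t, sin t]) = sqrt (a\<^sup>2 * (cos t)\<^sup>2 + (inverse a)\<^sup>2 * (sin t)\<^sup>2)"
  by (simp add: norm_vec2 dil_def mat2_simps power_mult_distrib)

lemma has_svd_opnorm:
  assumes svd: "has_svd A a s u" and a: "1 \<le> a"
  shows "opnorm A = a"
proof (rule antisym)
  have ia: "inverse a \<le> a" using a by (meson inverse_le_1_iff order_trans)
  have dil_le: "norm (dil a *v v) \<le> a * norm v" for v
  proof -
    have "(inverse a)\<^sup>2 \<le> a\<^sup>2" using ia a by (intro power_mono) auto
    hence "(a * v$1)\<^sup>2 + (inverse a * v$2)\<^sup>2 \<le> a\<^sup>2 * ((v$1)\<^sup>2 + (v$2)\<^sup>2)"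
      by (simp add: power_mult_distrib distrib_left mult_right_mono)
    hence "sqrt ((a * v$1)\<^sup>2 + (inverse a * v$2)\<^sup>2) \<le> sqrt (a\<^sup>2 * ((v$1)\<^sup>2 + (v$2)\<^sup>2))"
      by simp
    also have "\<dots> = a * sqrt ((v$1)\<^sup>2 + (v$2)\<^sup>2)" using a by (simp add: real_sqrt_mult)
    finally show ?thesis by (simp add: norm_vec2 dil_def mat2_simps)
  qed
  have "norm (A *v v) \<le> a * norm v" for v
    using dil_le[of "rot (pi / 2 - s) *v v"] by (simp add: has_svd_norm[OF svd] norm_rot_vec)
  thus "opnorm A \<le> a" unfolding opnorm_def by (rule onorm_le)
next
  define v :: "real^2" where "v = vector [cos (s - pi / 2), sin (s - pi / 2)]"
  have "norm (A *v v) = a"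
    using a unfolding has_svd_norm[OF svd] v_def rot_vec dil_unit by simp
  moreover have "norm v = 1" by (simp add: v_def norm_vec2)
  moreover have "norm (A *v v) \<le> onorm (\<lambda>v. A *v v) * norm v"
    by (rule onorm) (rule matrix_vector_mul_bounded_linear)
  ultimately show "a \<le> opnorm A" by (simp add: opnorm_def)
qed

text \<open>The real representatives of an element of \<open>\<real>/\<pi>\<int>\<close>.\<close>

definition angle_class :: "real \<Rightarrow> real set" where
  "angle_class t = {t + of_int k * pi | k. True}"

lemma angle_class_self: "t \<in> angle_class t"
  unfolding angle_class_def by (rule CollectI, rule exI[of _ 0]) simp

lemma has_svd_contracted:
  assumes svd: "has_svd A a s u" and a: "1 < a"
  shows "contracted_angle A = angle_class s"
proof -
  have gt: "(inverse a)\<^sup>2 < a\<^sup>2"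
    using a by (intro power_strict_mono) (auto intro: less_trans[of _ 1] simp: inverse_less_1_iff)
  have "norm (A *v vector [cos t, sin t]) = inverse (opnorm A) \<longleftrightarrow> t \<in> angle_class s" for t
  proof -
    define \<phi> where "\<phi> = pi / 2 - s + t"
    have "norm (A *v vector [cos t, sin t]) = inverse (opnorm A) \<longleftrightarrow>
        sqrt (a\<^sup>2 * (cos \<phi>)\<^sup>2 + (inverse a)\<^sup>2 * (sin \<phi>)\<^sup>2) = sqrt ((inverse a)\<^sup>2)"
      using a by (simp add: has_svd_norm[OF svd] rot_vec dil_unit has_svd_opnorm[OF svd] \<phi>_def)
    also have "\<dots> \<longleftrightarrow> a\<^sup>2 * (cos \<phi>)\<^sup>2 + (inverse a)\<^sup>2 * (sin \<phi>)\<^sup>2 = (inverse a)\<^sup>2"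
      by (rule real_sqrt_eq_iff)
    also have "\<dots> \<longleftrightarrow> (a\<^sup>2 - (inverse a)\<^sup>2) * (cos \<phi>)\<^sup>2 = 0"
      by (simp add: sin_squared_eq algebra_simps)
    also have "\<dots> \<longleftrightarrow> cos \<phi> = 0" using gt by simp
    also have "\<phi> = (t - s) + pi / 2" by (simp add: \<phi>_def)
    also have "cos \<dots> = - sin (t - s)" by (simp add: cos_add)
    also have "- sin (t - s) = 0 \<longleftrightarrow> t \<in> angle_class s"
      by (auto simp: sin_zero_iff_int2 angle_class_def algebra_simps)
    finally show ?thesis .
  qed
  thus ?thesis by (auto simp: contracted_angle_def)
qed

lemma matrix_inv_eqI:
  fixes A B :: "real^2^2"
  assumes "A ** B = mat 1" "B ** A = mat 1"
  shows "matrix_inv A = B"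
  unfolding matrix_inv_def
proof (rule some_equality)
  fix C assume "A ** C = mat 1 \<and> C ** A = mat 1"
  hence "C = C ** (A ** B)" using assms by simp
  also have "\<dots> = (C ** A) ** B" by (rule matrix_mul_assoc)
  finally show "C = B" using \<open>A ** C = mat 1 \<and> C ** A = mat 1\<close> by simp
qed (use assms in auto)

text \<open>Inversion exchanges the two directions, because \<open>D\<^sub>a R D\<^sub>a = R\<close> for the quarter turn \<open>R\<close> and
\<open>D\<^sub>a = diag(a, 1/a)\<close>.\<close>

lemma has_svd_inverse:
  assumes svd: "has_svd A a s u" and a: "0 < a"
  shows "has_svd (matrix_inv A) a u s"
proof -
  from svd obtain \<sigma> where \<sigma>: "\<sigma> \<in> {1, -1 :: real}" and A: "A = \<sigma> *\<^sub>R (rot u ** dil a ** rot (pi / 2 - s))"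
    unfolding has_svd_def by blast
  define B where "B = (- \<sigma>) *\<^sub>R (rot s ** dil a ** rot (pi / 2 - u))"
  have D: "dil a ** (rot (pi / 2) ** (dil a ** C)) = rot (pi / 2) ** C" for C
  proof -
    have "dil a ** (rot (pi / 2) ** dil a) = rot (pi / 2)"
      using a by (simp add: dil_def rot_def mat2_simps)
    thus ?thesis by (metis matrix_mul_assoc)
  qed
  have P: "rot pi = - mat 1" by (simp add: rot_def mat2_simps mat_def)
  have sq: "\<sigma> * \<sigma> = 1" using \<sigma> by auto
  have AB: "A ** B = (- (\<sigma> * \<sigma>)) *\<^sub>R (rot u ** (dil a ** (rot (pi / 2) ** (dil a ** rot (pi / 2 - u)))))"
    unfolding A B_def scaleR_matrix_mult by (simp add: matrix_mul_assoc[symmetric] rot_add')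
  have BA: "B ** A = (- (\<sigma> * \<sigma>)) *\<^sub>R (rot s ** (dil a ** (rot (pi / 2) ** (dil a ** rot (pi / 2 - s)))))"
    unfolding A B_def scaleR_matrix_mult by (simp add: matrix_mul_assoc[symmetric] rot_add')
  have "A ** B = mat 1" "B ** A = mat 1"
    unfolding AB BA D rot_add sq by (simp_all add: P)
  hence "matrix_inv A = B" by (rule matrix_inv_eqI)
  thus ?thesis using \<sigma> by (auto simp: has_svd_def B_def)
qed

lemma has_svd_expanded:
  assumes "has_svd A a s u" "1 < a"
  shows "expanded_angle A = angle_class u"
  using has_svd_contracted[OF has_svd_inverse] assms by (simp add: expanded_angle_def)

lemma has_svd_shift:
  assumes "has_svd A a s u" "s' \<in> angle_class s" "u' \<in> angle_class u"
  shows "has_svd A a s' u'"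
proof -
  from assms(1) obtain \<sigma> where \<sigma>: "\<sigma> \<in> {1, -1 :: real}" and A: "A = \<sigma> *\<^sub>R (rot u ** dil a ** rot (pi / 2 - s))"
    unfolding has_svd_def by blast
  from assms(2,3) obtain j k :: int where "s' = s + of_int j * pi" "u' = u + of_int k * pi"
    by (auto simp: angle_class_def)
  hence eq: "pi / 2 - s = (pi / 2 - s') + of_int j * pi" "u = u' + of_int (- k) * pi"
    by (simp_all add: algebra_simps)
  obtain \<tau> \<rho> where \<tau>: "\<tau> \<in> {1, -1 :: real}" "rot (pi / 2 - s) = \<tau> *\<^sub>R rot (pi / 2 - s')"
    and \<rho>: "\<rho> \<in> {1, -1 :: real}" "rot u = \<rho> *\<^sub>R rot u'"
    unfolding eq using rot_int_pi by blast
  have "A = (\<sigma> * \<tau> * \<rho>) *\<^sub>R (rot u' ** dil a ** rot (pi / 2 - s'))"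
    unfolding A \<tau>(2) \<rho>(2) by (simp add: scaleR_matrix_mult mult_ac)
  moreover have "\<sigma> * \<tau> * \<rho> \<in> {1, -1}" using \<sigma> \<tau> \<rho> by auto
  ultimately show ?thesis unfolding has_svd_def by blast
qed

text \<open>A real \<open>2 \<times> 2\<close> matrix is the sum of a conformal and an anticonformal one. For
\<open>R\<^sub>\<mu> diag(g, h) R\<^sub>\<nu>\<close> these parts have polar coordinates \<open>(g + h, \<mu> + \<nu>)\<close> and
\<open>(g - h, \<mu> - \<nu>)\<close>, up to a factor 2 in the moduli. A singular value decomposition can therefore
be read off from the polar coordinates of the two parts. The last hypothesis is
\<open>g h = 1\<close>, that is, determinant 1.\<close>

lemma conformal_decomposition:
  fixes M :: "real^2^2"
  assumes "M$1$1 + M$2$2 = X * cos (\<mu> + \<nu>)" "M$2$1 - M$1$2 = X * sin (\<mu> + \<nu>)"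
    and "M$1$1 - M$2$2 = Y * cos (\<mu> - \<nu>)" "M$2$1 + M$1$2 = Y * sin (\<mu> - \<nu>)"
    and "X\<^sup>2 - Y\<^sup>2 = 4"
  shows "M = rot \<mu> ** dil ((X + Y) / 2) ** rot \<nu>"
proof -
  define g h where "g = (X + Y) / 2" and "h = (X - Y) / 2"
  have X: "X = g + h" and Y: "Y = g - h" by (simp_all add: g_def h_def field_simps)
  have "g * h = 1" using assms(5) unfolding X Y by (simp add: power2_eq_square algebra_simps)
  hence h: "inverse g = h" by (simp add: inverse_unique)
  have "M$1$1 = g * cos \<mu> * cos \<nu> - h * sin \<mu> * sin \<nu>"
    "M$2$2 = h * cos \<mu> * cos \<nu> - g * sin \<mu> * sin \<nu>"
    "M$2$1 = g * sin \<mu> * cos \<nu> + h * cos \<mu> * sin \<nu>"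
    "M$1$2 = - g * cos \<mu> * sin \<nu> - h * sin \<mu> * cos \<nu>"
    using assms(1-4) unfolding X Y by (simp_all add: cos_add sin_add cos_diff sin_diff algebra_simps)
  thus ?thesis
    unfolding g_def[symmetric] by (simp add: rot_def dil_def h mat2_simps algebra_simps)
qed

lemma exists_svd:
  fixes A :: "real^2^2"
  assumes "det A = 1"
  obtains a s u where "1 \<le> a" "has_svd A a s u"
proof -
  \<comment> \<open>The conformal and the anticonformal part of \<open>A\<close>, as complex numbers.\<close>
  define z w where "z = Complex (A$1$1 + A$2$2) (A$2$1 - A$1$2)" and "w = Complex (A$1$1 - A$2$2) (A$2$1 + A$1$2)"
  define X Y where "X = cmod z" and "Y = cmod w"
  define \<mu> \<nu> where "\<mu> = (Arg z + Arg w) / 2" and "\<nu> = (Arg z - Arg w) / 2"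
  have z: "z = rcis X (Arg z)" and w: "w = rcis Y (Arg w)"
    by (simp_all add: X_def Y_def rcis_cmod_Arg)
  have sum: "\<mu> + \<nu> = Arg z" and diff: "\<mu> - \<nu> = Arg w" by (simp_all add: \<mu>_def \<nu>_def field_simps)
  have XY: "X\<^sup>2 - Y\<^sup>2 = 4"
    using assms by (simp add: X_def Y_def z_def w_def cmod_power2 det_2) (simp add: power2_eq_square algebra_simps)
  have "A = rot \<mu> ** dil ((X + Y) / 2) ** rot \<nu>"
  proof (rule conformal_decomposition[OF _ _ _ _ XY])
    show "A$1$1 + A$2$2 = X * cos (\<mu> + \<nu>)" "A$2$1 - A$1$2 = X * sin (\<mu> + \<nu>)"
      using arg_cong[OF z, of Re] arg_cong[OF z, of Im] by (simp_all add: sum z_def)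
    show "A$1$1 - A$2$2 = Y * cos (\<mu> - \<nu>)" "A$2$1 + A$1$2 = Y * sin (\<mu> - \<nu>)"
      using arg_cong[OF w, of Re] arg_cong[OF w, of Im] by (simp_all add: diff w_def)
  qed
  hence "has_svd A ((X + Y) / 2) (pi / 2 - \<nu>) \<mu>"
    unfolding has_svd_def by (intro bexI[of _ 1]) auto
  moreover have "1 \<le> (X + Y) / 2"
  proof -
    have "Y \<ge> 0" "X \<ge> 0" by (simp_all add: X_def Y_def)
    moreover have "4 \<le> X\<^sup>2" using XY zero_le_power2[of Y] by linarith
    hence "2\<^sup>2 \<le> X\<^sup>2" by simp
    ultimately have "2 \<le> X" using power2_le_imp_le by blast
    with \<open>Y \<ge> 0\<close> show ?thesis by simp
  qed
  ultimately show ?thesis by (rule that[rotated])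
qed

lemma opnorm_ge_1: "det A = 1 \<Longrightarrow> 1 \<le> opnorm A"
  by (rule exists_svd[of A]) (simp_all add: has_svd_opnorm)

text \<open>The decomposition provided by \<open>exists_svd\<close> has some contracted and expanded angles; any other
choice of representatives modulo \<open>\<pi>\<close> changes only the sign of the product.\<close>

lemma has_svdI:
  assumes det: "det A = 1" and gt: "1 < opnorm A"
    and s: "s \<in> contracted_angle A" and u: "u \<in> expanded_angle A"
  shows "has_svd A (opnorm A) s u"
proof -
  obtain a s0 u0 where a: "1 \<le> a" and svd: "has_svd A a s0 u0" using exists_svd[OF det] .
  have eq: "opnorm A = a" by (rule has_svd_opnorm[OF svd a])
  with gt have "1 < a" by simp
  thus ?thesis
    using has_svd_shift[OF svd, of s u] s u has_svd_contracted[OF svd] has_svd_expanded[OF svd] eq by simp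
qed

lemma angle_diff_class:
  assumes "\<bar>a - b\<bar> < pi / 2"
  shows "angle_diff (angle_class a) (angle_class b) = a - b"
  unfolding angle_diff_def
proof (rule the_equality)
  show "- pi / 2 < a - b \<and> a - b \<le> pi / 2 \<and> (\<exists>x\<in>angle_class a. \<exists>y\<in>angle_class b. a - b = x - y)"
  proof (intro conjI bexI)
    show "a \<in> angle_class a" "b \<in> angle_class b" by (rule angle_class_self)+
  qed (insert assms, linarith+)
next
  fix d assume d: "- pi / 2 < d \<and> d \<le> pi / 2 \<and> (\<exists>x\<in>angle_class a. \<exists>y\<in>angle_class b. d = x - y)"
  then obtain j k :: int where "d = (a + of_int j * pi) - (b + of_int k * pi)"
    by (auto simp: angle_class_def)
  hence e: "d - (a - b) = of_int (j - k) * pi" by (simp add: algebra_simps)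
  moreover have "\<bar>d - (a - b)\<bar> < pi" using d assms by (auto simp: abs_if split: if_splits)
  ultimately have "\<bar>of_int (j - k)\<bar> * pi < 1 * pi" by (simp add: abs_mult)
  hence "\<bar>real_of_int (j - k)\<bar> < 1" by (subst (asm) mult_less_cancel_right_pos) auto
  hence "j = k" by linarith
  with e show "d = a - b" by simp
qed

text \<open>The product of two decomposed matrices is, up to sign,
\<open>R\<^bsub>u'\<^esub> (D\<^sub>b R\<^sub>\<theta> D\<^sub>a) R\<^bsub>\<pi>/2 - s\<^esub>\<close> with \<open>\<theta> = u - s' + \<pi>/2\<close>, and the middle factor is
decomposed by its conformal and anticonformal parts. With \<open>\<alpha> = 1/a\<^sup>2\<close> and \<open>\<beta> = 1/b\<^sup>2\<close>
these have the components \<open>a b cos \<theta> (1 \<plusminus> \<alpha> \<beta>)\<close> and \<open>a b sin \<theta> (\<beta> \<plusminus> \<alpha>)\<close>, so their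
arguments are the arctangents of \<open>z\<close> and \<open>w\<close>. Both are small when \<open>a\<close> and \<open>b\<close> are large, which
is why the outer directions of the product barely move.\<close>

lemma has_svd_mult:
  assumes A: "has_svd A a s u" and B: "has_svd B b s' u'" and a: "1 < a" and b: "1 < b"
    and nz: "cos (u - s' + pi / 2) \<noteq> 0"
    and \<alpha>: "\<alpha> = (inverse a)\<^sup>2" and \<beta>: "\<beta> = (inverse b)\<^sup>2"
    and z: "z = (\<alpha> + \<beta>) * tan (u - s' + pi / 2) / (1 + \<alpha> * \<beta>)"
    and w: "w = (\<beta> - \<alpha>) * tan (u - s' + pi / 2) / (1 - \<alpha> * \<beta>)"
    and g: "g = a * b * \<bar>cos (u - s' + pi / 2)\<bar>
        * (((1 + \<alpha> * \<beta>) * sqrt (1 + z\<^sup>2) + (1 - \<alpha> * \<beta>) * sqrt (1 + w\<^sup>2)) / 2)"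
  shows "1 < g"
    and "has_svd (B ** A) g (s - (arctan z - arctan w) / 2) (u' + (arctan z + arctan w) / 2)"
proof -
  define \<theta> where "\<theta> = u - s' + pi / 2"
  define c S where "c = cos \<theta>" and "S = sin \<theta>"
  have c: "c \<noteq> 0" using nz by (simp add: c_def \<theta>_def)
  have tan: "tan \<theta> = S / c" by (simp add: tan_def c_def S_def)
  have sc: "S\<^sup>2 + c\<^sup>2 = 1" by (simp add: S_def c_def)
  have \<alpha>1: "0 < \<alpha>" "\<alpha> < 1" and \<beta>1: "0 < \<beta>" "\<beta> < 1"
    using a b unfolding \<alpha> \<beta> by (auto simp: power_less_one_iff inverse_less_1_iff)
  have ab: "\<alpha> * \<beta> < 1" using \<alpha>1 \<beta>1 mult_strict_mono[of \<alpha> 1 \<beta> 1] by simp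
  have aa: "a * a * \<alpha> = 1" and bb: "b * b * \<beta> = 1"
    using a b by (simp_all add: \<alpha> \<beta> power2_eq_square field_simps)
  define p q where "p = 1 + \<alpha> * \<beta>" and "q = 1 - \<alpha> * \<beta>"
  have pq: "p > 0" "q > 0" using \<alpha>1 \<beta>1 ab by (auto simp: p_def q_def add_pos_pos)
  have zp: "z * p * c = (\<alpha> + \<beta>) * S" and wq: "w * q * c = (\<beta> - \<alpha>) * S"
  proof -
    have "z = (\<alpha> + \<beta>) * (S / c) / p" "w = (\<beta> - \<alpha>) * (S / c) / q"
      unfolding z w p_def q_def tan[symmetric] \<theta>_def by (rule refl)+
    thus "z * p * c = (\<alpha> + \<beta>) * S" "w * q * c = (\<beta> - \<alpha>) * S" using pq c by simp_all
  qed
  define X Y where "X = a * b * \<bar>c\<bar> * p * sqrt (1 + z\<^sup>2)" and "Y = a * b * \<bar>c\<bar> * q * sqrt (1 + w\<^sup>2)"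
  have gXY: "g = (X + Y) / 2"
    unfolding g X_def Y_def p_def q_def c_def \<theta>_def by (simp add: algebra_simps)
  have XY: "X\<^sup>2 - Y\<^sup>2 = 4"
  proof -
    have sq: "(a * b * \<bar>c\<bar> * r * sqrt (1 + y\<^sup>2))\<^sup>2 = (a * b)\<^sup>2 * ((r * c)\<^sup>2 + (y * r * c)\<^sup>2)" for r y
    proof -
      have "(a * b * \<bar>c\<bar> * r * sqrt (1 + y\<^sup>2))\<^sup>2 = (a * b)\<^sup>2 * c\<^sup>2 * r\<^sup>2 * (1 + y\<^sup>2)"
        by (simp add: power_mult_distrib)
      thus ?thesis by (simp add: power_mult_distrib distrib_left mult_ac)
    qed
    have "X\<^sup>2 - Y\<^sup>2 = (a * b)\<^sup>2 * ((p * c)\<^sup>2 + ((\<alpha> + \<beta>) * S)\<^sup>2 - ((q * c)\<^sup>2 + ((\<beta> - \<alpha>) * S)\<^sup>2))"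
      unfolding X_def Y_def sq zp wq by (simp only: right_diff_distrib)
    also have "\<dots> = 4 * (a * a * \<alpha>) * (b * b * \<beta>) * (S\<^sup>2 + c\<^sup>2)"
      unfolding p_def q_def power2_eq_square by algebra
    finally show ?thesis by (simp add: aa bb sc)
  qed
  have Ypos: "0 < Y" unfolding Y_def using a b c pq
    by (intro mult_pos_pos) (auto simp: add_pos_nonneg)
  have Xpos: "0 < X" unfolding X_def using a b c pq
    by (intro mult_pos_pos) (auto simp: add_pos_nonneg)
  show g1: "1 < g"
  proof -
    have "4 < X\<^sup>2" using XY zero_less_power[OF Ypos, of 2] by linarith
    hence "2\<^sup>2 < X\<^sup>2" by simp
    hence "2 < X" using Xpos by (intro power2_less_imp_less[of 2 X]) auto
    thus ?thesis using Ypos by (simp add: gXY)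
  qed
  \<comment> \<open>The arctangent has positive cosine, so the middle factor is first multiplied by the
    sign of \<open>cos \<theta>\<close>.\<close>
  define sg where "sg = (if c > 0 then 1 else -1 :: real)"
  have sg: "sg \<in> {1, -1}" "sg * sg = 1" "sg * c = \<bar>c\<bar>" using c by (auto simp: sg_def)
  define M where "M = sg *\<^sub>R (dil b ** rot \<theta> ** dil a)"
  define \<mu> \<nu> where "\<mu> = (arctan z + arctan w) / 2" and "\<nu> = (arctan z - arctan w) / 2"
  have sum: "\<mu> + \<nu> = arctan z" and diff: "\<mu> - \<nu> = arctan w" by (simp_all add: \<mu>_def \<nu>_def field_simps)
  have ia: "inverse a = a * \<alpha>" and ib: "inverse b = b * \<beta>"
    using a b by (simp_all add: \<alpha> \<beta> power2_eq_square field_simps)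
  have M: "M$1$1 = sg * (a * b * c)" "M$2$2 = sg * (a * b * c * (\<alpha> * \<beta>))"
    "M$1$2 = - sg * (a * b * \<alpha> * S)" "M$2$1 = sg * (a * b * \<beta> * S)"
    unfolding M_def by (simp_all add: dil_def rot_def mat2_simps c_def[symmetric] S_def[symmetric] ia ib mult_ac)
  have X1: "X * (1 / sqrt (1 + z\<^sup>2)) = sg * (a * b * c * p)"
    and X2: "X * (z / sqrt (1 + z\<^sup>2)) = sg * (a * b * (z * p * c))"
    and Y1: "Y * (1 / sqrt (1 + w\<^sup>2)) = sg * (a * b * c * q)"
    and Y2: "Y * (w / sqrt (1 + w\<^sup>2)) = sg * (a * b * (w * q * c))"
    unfolding X_def Y_def sg(3)[symmetric] 
    by (simp_all add: mult_ac add_nonneg_eq_0_iff sum_power2_eq_zero_iff)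
  have "M = rot \<mu> ** dil ((X + Y) / 2) ** rot \<nu>"
  proof (rule conformal_decomposition[OF _ _ _ _ XY])
    show "M$1$1 + M$2$2 = X * cos (\<mu> + \<nu>)"
      unfolding sum cos_arctan X1 M by (simp add: p_def algebra_simps)
    show "M$2$1 - M$1$2 = X * sin (\<mu> + \<nu>)"
      unfolding sum sin_arctan X2 M zp by (simp add: algebra_simps)
    show "M$1$1 - M$2$2 = Y * cos (\<mu> - \<nu>)"
      unfolding diff cos_arctan Y1 M by (simp add: q_def algebra_simps)
    show "M$2$1 + M$1$2 = Y * sin (\<mu> - \<nu>)"
      unfolding diff sin_arctan Y2 M wq by (simp add: algebra_simps)
  qed
  hence "sg *\<^sub>R M = sg *\<^sub>R (rot \<mu> ** dil g ** rot \<nu>)" by (simp add: gXY)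
  hence D: "dil b ** rot \<theta> ** dil a = sg *\<^sub>R (rot \<mu> ** dil g ** rot \<nu>)"
    by (simp add: M_def sg(2))
  from A obtain \<sigma> where \<sigma>: "\<sigma> \<in> {1, -1 :: real}" and A': "A = \<sigma> *\<^sub>R (rot u ** dil a ** rot (pi / 2 - s))"
    unfolding has_svd_def by blast
  from B obtain \<tau> where \<tau>: "\<tau> \<in> {1, -1 :: real}" and B': "B = \<tau> *\<^sub>R (rot u' ** dil b ** rot (pi / 2 - s'))"
    unfolding has_svd_def by blast
  have "B ** A = (\<tau> * \<sigma>) *\<^sub>R (rot u' ** (dil b ** rot \<theta> ** dil a) ** rot (pi / 2 - s))"
    unfolding A' B' \<theta>_def
    by (simp add: scaleR_matrix_mult matrix_mul_assoc[symmetric] rot_add') (simp add: algebra_simps)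
  also have "\<dots> = (\<tau> * \<sigma> * sg) *\<^sub>R (rot (u' + \<mu>) ** dil g ** rot (pi / 2 - (s - \<nu>)))"
    unfolding D by (simp add: scaleR_matrix_mult matrix_mul_assoc[symmetric] rot_add' rot_add) (simp add: algebra_simps)
  finally have "B ** A = (\<tau> * \<sigma> * sg) *\<^sub>R (rot (u' + \<mu>) ** dil g ** rot (pi / 2 - (s - \<nu>)))" .
  moreover have "\<tau> * \<sigma> * sg \<in> {1, -1}" using \<sigma> \<tau> sg by auto
  ultimately show "has_svd (B ** A) g (s - (arctan z - arctan w) / 2) (u' + (arctan z + arctan w) / 2)"
    unfolding has_svd_def \<mu>_def \<nu>_def by blast
qed

section \<open>Products of matrices with Gevrey regularity\<close>

context gevrey_interval
begin

text \<open>One multiplication. Here \<open>A\<close> stands for a product already formed, whose expanded direction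
\<open>uA + d\<close> differs by a small \<open>d\<close> from that of its last factor, while the hypotheses on the
angle concern the unperturbed \<open>\<theta> = uA - sB + \<pi>/2\<close>. Since
\<open>cos (\<theta> + d) = cos \<theta> (cos d - tan \<theta> sin d)\<close>, the perturbation changes the cosine by a factor
\<open>1 + h\<close> with \<open>h\<close> small, of norm about \<open>P \<rho>\<close>. The quantities \<open>z\<close> and \<open>w\<close> of
\<open>has_svd_mult\<close> have norm about \<open>P \<rho>\<^sup>2\<close>, so each direction moves by at most
\<open>\<rho> / n\<close>. The new norm is \<open>a b \<bar>cos \<theta>\<bar> (1 + h) (1 + S)\<close>, and the two correcting factors
cost an absolute constant, at most \<open>23\<^sup>2 \<le> C\<close>.\<close>

lemma svd_step:
  fixes A B :: "real \<Rightarrow> real^2^2" and a b d sA sB uA uB \<theta> :: "real \<Rightarrow> real" and C P \<rho> n :: real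
  assumes C: "1000 \<le> C" and P: "C \<le> P" and \<rho>: "0 < \<rho>" and n: "1 \<le> n"
    and small: "n * P ^ 4 * \<rho> \<le> 1"
    and A: "\<And>x. x \<in> I \<Longrightarrow> has_svd (A x) (a x) (sA x) (uA x + d x)" "\<And>x. x \<in> I \<Longrightarrow> 1 < a x"
    and B: "\<And>x. x \<in> I \<Longrightarrow> has_svd (B x) (b x) (sB x) (uB x)" "\<And>x. x \<in> I \<Longrightarrow> 1 < b x"
    and \<theta>: "\<And>x. x \<in> I \<Longrightarrow> \<theta> x = uA x - sB x + pi / 2"
    and nz: "\<And>x. x \<in> I \<Longrightarrow> cos (\<theta> x) \<noteq> 0"
    and bds: "bd a NA" "bd b NB" "bd (\<lambda>x. inverse (a x)) RA" "RA \<le> \<rho>"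
      "bd (\<lambda>x. inverse (b x)) RB" "RB \<le> \<rho>" "bd d \<rho>"
    and trig: "bd (\<lambda>x. cos (\<theta> x)) C" "bd (\<lambda>x. 1 / cos (\<theta> x)) P" "bd (\<lambda>x. tan (\<theta> x)) P"
  shows "\<exists>g \<nu> \<mu>. (\<forall>x\<in>I. has_svd (B x ** A x) (g x) (sA x - \<nu> x) (uB x + \<mu> x) \<and> 1 < g x
            \<and> a x * b x / P \<le> g x)
     \<and> bd g (C\<^sup>2 * NA * NB) \<and> bd (\<lambda>x. inverse (g x)) (C * P * RA * RB)
     \<and> bd \<nu> (\<rho> / n) \<and> bd \<mu> (\<rho> / n)"
proof -
  have P1: "1000 \<le> P" using C P by simp
  \<comment> \<open>Numerical slack: \<open>P \<rho> n\<close> is small with room for all the constants below.\<close>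
  have P3: "1000000000 \<le> P ^ 3" using power_mono[OF P1, of 3] by simp
  have P\<rho>n: "1000000000 * (P * \<rho> * n) \<le> 1"
  proof -
    have "1000000000 * (P * \<rho> * n) \<le> P ^ 3 * (P * \<rho> * n)"
      using P3 P1 \<rho> n by (intro mult_right_mono) auto
    also have "\<dots> = n * P ^ 4 * \<rho>" by (simp add: power_numeral_reduce)
    finally show ?thesis using small by simp
  qed
  have P\<rho>: "1000000000 * (P * \<rho>) \<le> 1"
  proof -
    have "P * \<rho> * 1 \<le> P * \<rho> * n" using P1 \<rho> n by (intro mult_left_mono) auto
    thus ?thesis using P\<rho>n by simp
  qed
  have \<rho>1: "1000 * \<rho> \<le> P * \<rho>" using P1 \<rho> by (intro mult_right_mono) auto
  have \<rho>2: "\<rho> \<le> 1 / 1000000" using P\<rho> \<rho>1 by linarith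
  have \<rho>sq: "\<rho> * \<rho> \<le> \<rho>" using \<rho>2 \<rho> mult_left_mono[of \<rho> 1 \<rho>] by simp
  note RA = bd_mono[OF bds(3,4)] and RB = bd_mono[OF bds(5,6)]

  have sin: "bd (\<lambda>x. sin (d x)) (2 * \<rho>)" and cos1: "bd (\<lambda>x. cos (d x) - 1) (2 * \<rho>)"
    using bd_sin[OF bds(7)] bd_cos[OF bds(7)] \<rho>2 by simp_all
  define c T where "c x = cos (\<theta> x + d x)" and "T x = tan (\<theta> x + d x)" for x
  define h where "h x = (cos (d x) - 1) - tan (\<theta> x) * sin (d x)" for x
  have "bd h (2 * \<rho> + P * (2 * \<rho>))"
    unfolding h_def by (intro bd_diff bd_mult cos1 trig sin)
  hence h: "bd h (1 / 2)" by (rule bd_mono) (use P\<rho> \<rho>2 in \<open>simp add: mult_ac\<close>)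
  note hinv = bd_inverse[OF h order_refl]
  have h8: "\<bar>h x\<bar> \<le> 1 / 8" if "x \<in> I" for x using bd_small_abs[OF h _ that] by simp
  have c_eq: "c x = cos (\<theta> x) * (1 + h x)" if "x \<in> I" for x
    using nz[OF that] by (simp add: c_def h_def cos_add tan_def algebra_simps)
  have c_nz: "c x \<noteq> 0" if "x \<in> I" for x
    using c_eq[OF that] nz[OF that] h8[OF that] by auto
  have "bd (\<lambda>x. cos (\<theta> x) * (1 + h x)) (C * (22 + 1 / 2))"
    by (intro bd_mult bd_add bd_one h trig)
  hence "bd c (C * (22 + 1 / 2))" by (rule bd_cong) (rule c_eq)
  hence "bd c (23 * C)" by (rule bd_mono) (use C in simp)
  hence abs_c: "bd (\<lambda>x. \<bar>c x\<bar>) (23 * C)" by (rule bd_abs) (rule c_nz)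
  have "bd (\<lambda>x. 1 / cos (\<theta> x) * inverse (1 + h x)) (P * 23)"
    by (intro bd_mult trig hinv)
  hence "bd (\<lambda>x. inverse (c x)) (P * 23)"
    by (rule bd_cong) (simp add: c_eq divide_inverse)
  hence "bd (\<lambda>x. \<bar>inverse (c x)\<bar>) (P * 23)" by (rule bd_abs) (simp add: c_nz)
  hence abs_ic: "bd (\<lambda>x. inverse \<bar>c x\<bar>) (P * 23)" by (rule bd_cong) simp

  have "bd (\<lambda>x. (tan (\<theta> x) * ((cos (d x) - 1) + 1) + sin (d x)) * inverse (1 + h x))
      ((P * (2 * \<rho> + 22) + 2 * \<rho>) * 23)"
    by (intro bd_mult bd_add bd_one cos1 sin trig hinv)
  hence "bd T ((P * (2 * \<rho> + 22) + 2 * \<rho>) * 23)"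
  proof (rule bd_cong)
    fix x assume x: "x \<in> I"
    have "T x = (sin (\<theta> x) * cos (d x) + cos (\<theta> x) * sin (d x)) / c x"
      by (simp add: T_def c_def tan_def sin_add)
    also have "\<dots> = (tan (\<theta> x) * cos (d x) + sin (d x)) * inverse (1 + h x)"
    proof -
      have "(p * q + r * t) / (r * y) = (p / r * q + t) * inverse y" if "r \<noteq> 0" "y \<noteq> 0" for p q r t y :: real
        using that by (simp add: field_simps)
      moreover have "1 + h x \<noteq> 0" using h8[OF x] by auto
      ultimately show ?thesis using nz[OF x] unfolding c_eq[OF x] tan_def by blast
    qed
    finally show "T x = (tan (\<theta> x) * ((cos (d x) - 1) + 1) + sin (d x)) * inverse (1 + h x)" by simp
  qed
  hence T: "bd T (600 * P)" by (rule bd_mono) (use P\<rho> \<rho>2 P1 in \<open>simp add: algebra_simps\<close>)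

  define \<alpha> \<beta> where "\<alpha> x = (inverse (a x))\<^sup>2" and "\<beta> x = (inverse (b x))\<^sup>2" for x
  have \<alpha>: "bd \<alpha> (\<rho> * \<rho>)"
    by (rule bd_cong[OF bd_mult[OF RA RA]]) (simp add: \<alpha>_def power2_eq_square)
  have \<beta>: "bd \<beta> (\<rho> * \<rho>)"
    by (rule bd_cong[OF bd_mult[OF RB RB]]) (simp add: \<beta>_def power2_eq_square)
  have "bd (\<lambda>x. \<alpha> x * \<beta> x) (\<rho> * \<rho> * (\<rho> * \<rho>))" by (intro bd_mult \<alpha> \<beta>)
  hence \<alpha>\<beta>: "bd (\<lambda>x. \<alpha> x * \<beta> x) (1 / 2)"
  proof (rule bd_mono)
    have "\<rho> * \<rho> * (\<rho> * \<rho>) \<le> \<rho> * \<rho>" using \<rho>sq \<rho> by (intro mult_mono) auto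
    thus "\<rho> * \<rho> * (\<rho> * \<rho>) \<le> 1 / 2" using \<rho>sq \<rho>2 by linarith
  qed
  note \<alpha>\<beta>' = bd_minus[OF \<alpha>\<beta>]
  \<comment> \<open>\<open>Z\<close> bounds \<open>z\<close> and \<open>w\<close>: the constant is \<open>2 * 600 * 23 = 27600\<close>, rounded up.\<close>
  define Z where "Z = 30000 * (P * \<rho>) * \<rho>"
  have Zn: "2 * Z \<le> \<rho> / n"
  proof -
    have "2 * Z * n = (60000 * (P * \<rho> * n)) * \<rho>" by (simp add: Z_def)
    also have "\<dots> \<le> 1 * \<rho>" using P\<rho>n \<rho> by (intro mult_right_mono) auto
    finally show ?thesis using n by (simp add: field_simps)
  qed
  have Z0: "0 \<le> Z" using P1 \<rho> by (simp add: Z_def)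
  have Z1: "Z \<le> 1 / 100"
  proof -
    have "\<rho> / n \<le> \<rho> / 1" using n \<rho> by (intro divide_left_mono) auto
    thus ?thesis using Zn \<rho>2 Z0 by simp
  qed
  have ZZ: "Z * Z \<le> 1 / 10000" using mult_mono[OF Z1 Z1] Z0 by simp
  hence ZZ2: "Z * Z \<le> 1 / 2" by linarith
  have num: "(\<rho> * \<rho> + \<rho> * \<rho>) * (600 * P) * 23 \<le> Z"
  proof -
    have "(\<rho> * \<rho> + \<rho> * \<rho>) * (600 * P) * 23 = 27600 * (P * \<rho> * \<rho>)" by algebra
    also have "\<dots> \<le> 30000 * (P * \<rho> * \<rho>)" using P1 \<rho> by (intro mult_right_mono) auto
    finally show ?thesis by (simp add: Z_def)
  qed
  define z w where "z x = (\<alpha> x + \<beta> x) * T x / (1 + \<alpha> x * \<beta> x)"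
    and "w x = (\<beta> x - \<alpha> x) * T x / (1 - \<alpha> x * \<beta> x)" for x
  have "bd (\<lambda>x. (\<alpha> x + \<beta> x) * T x * inverse (1 + \<alpha> x * \<beta> x)) ((\<rho> * \<rho> + \<rho> * \<rho>) * (600 * P) * 23)"
    by (intro bd_mult bd_add \<alpha> \<beta> T bd_inverse[OF \<alpha>\<beta> order_refl])
  hence z: "bd z Z"
    by (rule bd_cong_mono[OF _ _ num]) (simp add: z_def divide_inverse)
  have "bd (\<lambda>x. (\<beta> x - \<alpha> x) * T x * inverse (1 + - (\<alpha> x * \<beta> x))) ((\<rho> * \<rho> + \<rho> * \<rho>) * (600 * P) * 23)"
    by (intro bd_mult bd_diff \<alpha> \<beta> T bd_inverse[OF \<alpha>\<beta>' order_refl])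
  hence w: "bd w Z"
    by (rule bd_cong_mono[OF _ _ num]) (simp add: w_def divide_inverse)
  have atz: "bd (\<lambda>x. arctan (z x)) (2 * Z)" and atw: "bd (\<lambda>x. arctan (w x)) (2 * Z)"
    using bd_arctan[OF z] bd_arctan[OF w] Z1 by simp_all

  \<comment> \<open>In the average of \<open>(1 + \<alpha> \<beta>) sqrt (1 + z\<^sup>2)\<close> and \<open>(1 - \<alpha> \<beta>) sqrt (1 + w\<^sup>2)\<close> the
    terms \<open>\<plusminus> \<alpha> \<beta>\<close> cancel, and \<open>S\<close> is what remains beyond 1.\<close>
  define S where "S x = 1 / 2 * ((1 + \<alpha> x * \<beta> x) * (sqrt (1 + z x * z x) - 1)
      + (1 + - (\<alpha> x * \<beta> x)) * (sqrt (1 + w x * w x) - 1))" for x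
  have "bd S (\<bar>1 / 2\<bar> * ((22 + 1 / 2) * (2 * (Z * Z)) + (22 + 1 / 2) * (2 * (Z * Z))))"
    unfolding S_def by (intro bd_cmult bd_add bd_mult bd_one bd_sqrt[OF bd_mult[OF z z] ZZ2]
        bd_sqrt[OF bd_mult[OF w w] ZZ2] \<alpha>\<beta> \<alpha>\<beta>')
  hence S: "bd S (1 / 2)" by (rule bd_mono) (use ZZ in simp)
  have S8: "\<bar>S x\<bar> \<le> 1 / 8" if "x \<in> I" for x using bd_small_abs[OF S _ that] by simp

  define g where "g x = a x * b x * \<bar>c x\<bar> * (1 + S x)" for x
  have svd: "1 < g x"
    "has_svd (B x ** A x) (g x) (sA x - (arctan (z x) - arctan (w x)) / 2) (uB x + (arctan (z x) + arctan (w x)) / 2)"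
    if x: "x \<in> I" for x
  proof -
    have th: "uA x + d x - sB x + pi / 2 = \<theta> x + d x" using \<theta>[OF x] by simp
    have ge: "g x = a x * b x * \<bar>c x\<bar> * (((1 + \<alpha> x * \<beta> x) * sqrt (1 + (z x)\<^sup>2) + (1 - \<alpha> x * \<beta> x) * sqrt (1 + (w x)\<^sup>2)) / 2)"
      unfolding g_def S_def power2_eq_square by (simp add: field_simps)
    note res = has_svd_mult[OF A(1)[OF x] B(1)[OF x] A(2)[OF x] B(2)[OF x], unfolded th,
        OF c_nz[OF x, unfolded c_def] \<alpha>_def \<beta>_def z_def[unfolded T_def] w_def[unfolded T_def] ge[unfolded c_def]]
    show "1 < g x"
    "has_svd (B x ** A x) (g x) (sA x - (arctan (z x) - arctan (w x)) / 2) (uB x + (arctan (z x) + arctan (w x)) / 2)"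
      by (rule res)+
  qed
  have NA0: "0 \<le> NA * NB" and RA0: "0 \<le> RA * RB" using bds bd_nonneg by (meson mult_nonneg_nonneg)+
  have "bd g (NA * NB * (23 * C) * (22 + 1 / 2))"
    unfolding g_def by (intro bd_mult bd_add bds abs_c bd_one S)
  hence bg: "bd g (C\<^sup>2 * NA * NB)"
  proof (rule bd_mono)
    have "NA * NB * (23 * C) * (22 + 1 / 2) = (NA * NB * C) * (23 * (22 + 1 / 2))" by simp
    also have "\<dots> \<le> (NA * NB * C) * C" using C NA0 by (intro mult_left_mono) auto
    finally show "NA * NB * (23 * C) * (22 + 1 / 2) \<le> C\<^sup>2 * NA * NB"
      by (simp add: power2_eq_square mult_ac)
  qed
  have "bd (\<lambda>x. inverse (a x) * inverse (b x) * inverse \<bar>c x\<bar> * inverse (1 + S x)) (RA * RB * (P * 23) * 23)"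
    by (intro bd_mult bds abs_ic bd_inverse[OF S order_refl])
  hence big: "bd (\<lambda>x. inverse (g x)) (C * P * RA * RB)"
  proof (rule bd_cong_mono)
    have "RA * RB * (P * 23) * 23 = (RA * RB * P) * 529" by simp
    also have "\<dots> \<le> (RA * RB * P) * C" using C RA0 P1 by (intro mult_left_mono) auto
    finally show "RA * RB * (P * 23) * 23 \<le> C * P * RA * RB" by (simp add: mult_ac)
  qed (simp add: g_def)
  have lower: "a x * b x / P \<le> g x" if x: "x \<in> I" for x
  proof -
    have "\<bar>1 / cos (\<theta> x)\<bar> \<le> P / 4" by (rule bd_abs_le[OF trig(2) x])
    hence "4 / P \<le> \<bar>cos (\<theta> x)\<bar>" using nz[OF x] P1 by (simp add: field_simps)
    moreover have "7 / 8 \<le> \<bar>1 + h x\<bar>" "7 / 8 \<le> 1 + S x" using h8[OF x] S8[OF x] by auto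
    ultimately have "4 / P * (7 / 8) * (7 / 8) \<le> \<bar>cos (\<theta> x)\<bar> * \<bar>1 + h x\<bar> * (1 + S x)"
      using P1 by (intro mult_mono) auto
    moreover have "1 / P \<le> 4 / P * (7 / 8) * (7 / 8)" using P1 by (simp add: field_simps)
    ultimately have "1 / P \<le> \<bar>c x\<bar> * (1 + S x)" by (simp add: c_eq[OF x] abs_mult)
    hence "a x * b x * (1 / P) \<le> a x * b x * (\<bar>c x\<bar> * (1 + S x))"
      using A(2)[OF x] B(2)[OF x] by (intro mult_left_mono) auto
    thus ?thesis by (simp add: g_def mult_ac)
  qed
  have "bd (\<lambda>x. 1 / 2 * (arctan (z x) - arctan (w x))) (\<bar>1 / 2\<bar> * (2 * Z + 2 * Z))"
    by (intro bd_cmult bd_diff atz atw)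
  hence \<nu>: "bd (\<lambda>x. (arctan (z x) - arctan (w x)) / 2) (\<rho> / n)"
    by (rule bd_cong_mono) (use Zn in auto)
  have "bd (\<lambda>x. 1 / 2 * (arctan (z x) + arctan (w x))) (\<bar>1 / 2\<bar> * (2 * Z + 2 * Z))"
    by (intro bd_cmult bd_add atz atw)
  hence \<mu>: "bd (\<lambda>x. (arctan (z x) + arctan (w x)) / 2) (\<rho> / n)"
    by (rule bd_cong_mono) (use Zn in auto)
  show ?thesis
    by (rule exI[of _ g], rule exI[of _ "\<lambda>x. (arctan (z x) - arctan (w x)) / 2"],
        rule exI[of _ "\<lambda>x. (arctan (z x) + arctan (w x)) / 2"], intro conjI ballI svd lower bg big \<nu> \<mu>)
qed

text \<open>Multiplying the factors one after the other. The contracted direction accumulates one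
displacement of at most \<open>\<rho> / n\<close> per multiplication, whereas the expanded direction is displaced only
relative to the last factor, so that its bound does not grow. The reciprocal of the norm stays
below \<open>\<rho>\<close> because each further factor contributes \<open>C P \<rho> \<le> 1\<close>; this keeps the hypotheses
of \<open>svd_step\<close> in force.\<close>

lemma svd_iterate:
  fixes E :: "nat \<Rightarrow> real \<Rightarrow> real^2^2" and e sa ua :: "nat \<Rightarrow> real \<Rightarrow> real" and C P \<rho> n :: real
  assumes C: "1000 \<le> C" and P: "C \<le> P" and \<rho>: "0 < \<rho>" and n: "1 \<le> n"
    and small: "n * P ^ 4 * \<rho> \<le> 1"
    and E: "\<And>l x. l \<le> k \<Longrightarrow> x \<in> I \<Longrightarrow> has_svd (E l x) (e l x) (sa l x) (ua l x)"
      "\<And>l x. l \<le> k \<Longrightarrow> x \<in> I \<Longrightarrow> 1 < e l x"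
    and bds: "\<And>l. l \<le> k \<Longrightarrow> bd (e l) (N l)" "\<And>l. l \<le> k \<Longrightarrow> bd (\<lambda>x. inverse (e l x)) (R l)"
      "\<And>l. l \<le> k \<Longrightarrow> R l \<le> \<rho>"
    and trig: "\<And>l x. l < k \<Longrightarrow> x \<in> I \<Longrightarrow> cos (ua l x - sa (Suc l) x + pi / 2) \<noteq> 0"
      "\<And>l. l < k \<Longrightarrow> bd (\<lambda>x. cos (ua l x - sa (Suc l) x + pi / 2)) C"
      "\<And>l. l < k \<Longrightarrow> bd (\<lambda>x. 1 / cos (ua l x - sa (Suc l) x + pi / 2)) P"
      "\<And>l. l < k \<Longrightarrow> bd (\<lambda>x. tan (ua l x - sa (Suc l) x + pi / 2)) P"
  shows "\<exists>a \<nu> \<mu>. (\<forall>x\<in>I. has_svd (iter_prod E (Suc k) x) (a x) (sa 0 x - \<nu> x) (ua k x + \<mu> x)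
            \<and> 1 < a x \<and> (\<Prod>l\<le>k. e l x) / P ^ k \<le> a x)
     \<and> bd a (C ^ (2 * k) * (\<Prod>l\<le>k. N l)) \<and> bd (\<lambda>x. inverse (a x)) ((C * P) ^ k * (\<Prod>l\<le>k. R l))
     \<and> (C * P) ^ k * (\<Prod>l\<le>k. R l) \<le> \<rho>
     \<and> bd \<nu> (real k * (\<rho> / n)) \<and> bd \<mu> (\<rho> / n)"
  using E bds trig
proof (induction k)
  case 0
  show ?case
    by (rule exI[of _ "e 0"], rule exI[of _ "\<lambda>x. 0"], rule exI[of _ "\<lambda>x. 0"])
       (use 0 \<rho> n in \<open>auto intro: bd_zero\<close>)
next
  case (Suc k)
  have P1: "1 \<le> P" "C \<le> P" using C P by auto
  have \<rho>n: "\<rho> / n \<le> \<rho>" using n \<rho> divide_left_mono[of 1 n \<rho>] by simp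
  have CP\<rho>: "C * P * \<rho> \<le> 1"
  proof -
    have "C * P * \<rho> \<le> n * P ^ 4 * \<rho>"
    proof (intro mult_right_mono)
      have "C * P \<le> P ^ 2" using P1 C by (simp add: power2_eq_square)
      also have "\<dots> \<le> P ^ 4" using P1 by (intro power_increasing) auto
      also have "\<dots> = 1 * P ^ 4" by simp
      also have "\<dots> \<le> n * P ^ 4" using n P1 by (intro mult_right_mono) auto
      finally show "C * P \<le> n * P ^ 4" .
    qed (use \<rho> in simp)
    with small show ?thesis by simp
  qed
  have "\<exists>a \<nu> \<mu>. (\<forall>x\<in>I. has_svd (iter_prod E (Suc k) x) (a x) (sa 0 x - \<nu> x) (ua k x + \<mu> x)
            \<and> 1 < a x \<and> (\<Prod>l\<le>k. e l x) / P ^ k \<le> a x)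
     \<and> bd a (C ^ (2 * k) * (\<Prod>l\<le>k. N l)) \<and> bd (\<lambda>x. inverse (a x)) ((C * P) ^ k * (\<Prod>l\<le>k. R l))
     \<and> (C * P) ^ k * (\<Prod>l\<le>k. R l) \<le> \<rho>
     \<and> bd \<nu> (real k * (\<rho> / n)) \<and> bd \<mu> (\<rho> / n)"
    by (rule Suc.IH) (use Suc.prems in \<open>auto simp: less_Suc_eq\<close>)
  then obtain a \<nu> \<mu> where IH: "\<And>x. x \<in> I \<Longrightarrow> has_svd (iter_prod E (Suc k) x) (a x) (sa 0 x - \<nu> x) (ua k x + \<mu> x)"
    "\<And>x. x \<in> I \<Longrightarrow> 1 < a x" "\<And>x. x \<in> I \<Longrightarrow> (\<Prod>l\<le>k. e l x) / P ^ k \<le> a x"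
    "bd a (C ^ (2 * k) * (\<Prod>l\<le>k. N l))" "bd (\<lambda>x. inverse (a x)) ((C * P) ^ k * (\<Prod>l\<le>k. R l))"
    "(C * P) ^ k * (\<Prod>l\<le>k. R l) \<le> \<rho>" "bd \<nu> (real k * (\<rho> / n))" "bd \<mu> (\<rho> / n)"
    by blast
  note step = svd_step[OF C P \<rho> n small IH(1,2) Suc.prems(1,2)[OF order_refl] refl
      Suc.prems(6)[OF lessI] IH(4) Suc.prems(3)[OF order_refl] IH(5,6)
      Suc.prems(4,5)[OF order_refl] bd_mono[OF IH(8) \<rho>n] Suc.prems(7-9)[OF lessI]]
  from step obtain g \<nu>' \<mu>' where g: "\<And>x. x \<in> I \<Longrightarrow> has_svd (E (Suc k) x ** iter_prod E (Suc k) x) (g x)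
        (sa 0 x - \<nu> x - \<nu>' x) (ua (Suc k) x + \<mu>' x)"
      "\<And>x. x \<in> I \<Longrightarrow> 1 < g x" "\<And>x. x \<in> I \<Longrightarrow> a x * e (Suc k) x / P \<le> g x"
      "bd g (C\<^sup>2 * (C ^ (2 * k) * (\<Prod>l\<le>k. N l)) * N (Suc k))"
      "bd (\<lambda>x. inverse (g x)) (C * P * ((C * P) ^ k * (\<Prod>l\<le>k. R l)) * R (Suc k))"
      "bd \<nu>' (\<rho> / n)" "bd \<mu>' (\<rho> / n)" by blast
  have R0: "0 \<le> (C * P) ^ k * (\<Prod>l\<le>k. R l)" by (rule bd_nonneg[OF IH(5)])
  have R1: "0 \<le> R (Suc k)" using bd_nonneg Suc.prems(4) by blast
  show ?case
  proof (rule exI[of _ g], rule exI[of _ "\<lambda>x. \<nu> x + \<nu>' x"], rule exI[of _ \<mu>'], intro conjI ballI)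
    fix x assume x: "x \<in> I"
    show "has_svd (iter_prod E (Suc (Suc k)) x) (g x) (sa 0 x - (\<nu> x + \<nu>' x)) (ua (Suc k) x + \<mu>' x)"
      using g(1)[OF x] by (simp add: diff_diff_eq)
    show "1 < g x" by (rule g(2)[OF x])
    have "(\<Prod>l\<le>Suc k. e l x) / P ^ Suc k = (\<Prod>l\<le>k. e l x) / P ^ k * e (Suc k) x / P"
      by simp
    also have "\<dots> \<le> a x * e (Suc k) x / P"
      using IH(3)[OF x] Suc.prems(2)[OF order_refl x] P1 by (intro divide_right_mono mult_right_mono) auto
    also have "\<dots> \<le> g x" by (rule g(3)[OF x])
    finally show "(\<Prod>l\<le>Suc k. e l x) / P ^ Suc k \<le> g x" .
  next
    show "bd g (C ^ (2 * Suc k) * (\<Prod>l\<le>Suc k. N l))"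
      using g(4) by (simp add: power2_eq_square mult_ac)
    show "bd (\<lambda>x. inverse (g x)) ((C * P) ^ Suc k * (\<Prod>l\<le>Suc k. R l))"
      using g(5) by (simp add: mult_ac)
    have "(C * P) ^ Suc k * (\<Prod>l\<le>Suc k. R l) = (C * P * R (Suc k)) * ((C * P) ^ k * (\<Prod>l\<le>k. R l))"
      by (simp add: mult_ac)
    also have "\<dots> \<le> (C * P * \<rho>) * \<rho>"
    proof (rule mult_mono)
      show "C * P * R (Suc k) \<le> C * P * \<rho>"
        using Suc.prems(5)[OF order_refl] C P1 by (intro mult_left_mono) auto
    qed (use IH(6) R0 C P1 \<rho> in auto)
    also have "\<dots> \<le> 1 * \<rho>" using CP\<rho> \<rho> by (intro mult_right_mono) auto
    finally show "(C * P) ^ Suc k * (\<Prod>l\<le>Suc k. R l) \<le> \<rho>" by simp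
    show "bd (\<lambda>x. \<nu> x + \<nu>' x) (real (Suc k) * (\<rho> / n))"
      by (rule bd_mono[OF bd_add[OF IH(7) g(6)]]) (simp add: add_divide_distrib distrib_right)
    show "bd \<mu>' (\<rho> / n)" by (rule g(7))
  qed
qed

end

context gevrey_interval
begin

text \<open>The Gevrey norm decreases as \<open>K\<close> grows.\<close>

lemma gevrey_norm_le_of_bd:
  assumes "bd f B" "K \<le> K'"
  shows "gevrey_norm I s K' f \<le> ennreal B"
proof -
  interpret K': gevrey_interval I s K'
    using interval nondegenerate s_ge_1 K_pos assms(2) by unfold_locales auto
  show ?thesis
    using gevrey_bd_mono_K[OF _ bd_nonneg[OF assms(1)] K_pos assms(2)] assms(1)
    by (simp add: K'.gevrey_norm_le_iff[OF bd_nonneg[OF assms(1)]] bd_def)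
qed

lemma bdI_norm: "gevrey_norm I s K f \<le> ennreal B \<Longrightarrow> 0 \<le> B \<Longrightarrow> bd f B"
  by (simp add: gevrey_norm_le_iff bd_def)

text \<open>Here \<open>\<rho>\<close> is a small bound for the norms of all \<open>1/e l\<close>, and \<open>G\<close> measures how close the
angles come to the degenerate ones. The bounds follow from \<open>svd_iterate\<close>, whose displacements
are the angle differences below because they are smaller than \<open>\<pi>/2\<close> in modulus.\<close>

lemma product_estimates:
  fixes E :: "nat \<Rightarrow> real \<Rightarrow> real^2^2" and sa ua :: "nat \<Rightarrow> real \<Rightarrow> real" and C G \<rho> K' :: real and n :: nat
  defines "e \<equiv> \<lambda>l x. opnorm (E l x)" and "\<theta> \<equiv> \<lambda>l x. ua (l - 1) x - sa l x + pi / 2"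
    and "en \<equiv> \<lambda>x. opnorm (iter_prod E n x)"
  assumes C: "1000 \<le> C" and G: "1 \<le> G" and \<rho>: "0 < \<rho>" and n: "1 \<le> n" and KK': "K \<le> K'"
    and small: "real n * (C * G) ^ 4 * \<rho> \<le> 1"
    and E: "\<And>l x. l < n \<Longrightarrow> x \<in> I \<Longrightarrow> det (E l x) = 1"
    and sa: "\<And>l x. l < n \<Longrightarrow> x \<in> I \<Longrightarrow> sa l x \<in> contracted_angle (E l x)"
    and ua: "\<And>l x. l < n \<Longrightarrow> x \<in> I \<Longrightarrow> ua l x \<in> expanded_angle (E l x)"
    and trig: "\<And>l x. 1 \<le> l \<Longrightarrow> l < n \<Longrightarrow> x \<in> I \<Longrightarrow> cos (\<theta> l x) \<noteq> 0"
      "\<And>l. 1 \<le> l \<Longrightarrow> l < n \<Longrightarrow> gevrey_norm I s K (\<lambda>x. 1 / cos (\<theta> l x)) \<le> ennreal (C * G)"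
      "\<And>l. 1 \<le> l \<Longrightarrow> l < n \<Longrightarrow> gevrey_norm I s K (\<lambda>x. tan (\<theta> l x)) \<le> ennreal (C * G)"
      "\<And>l. 1 \<le> l \<Longrightarrow> l < n \<Longrightarrow> gevrey_norm I s K (\<lambda>x. cos (\<theta> l x)) \<le> ennreal C"
    and e: "\<And>l. l < n \<Longrightarrow> gevrey_norm I s K (e l) < \<infinity>"
      "\<And>l. l < n \<Longrightarrow> gevrey_norm I s K (\<lambda>x. inverse (e l x)) \<le> ennreal \<rho>"
  shows "(\<Prod>l<n. INF x\<in>I. e l x) / (C * G) ^ n \<le> (INF x\<in>I. en x)"
    and "gevrey_norm I s K' en \<le> ennreal (C ^ (2 * n)) * (\<Prod>l<n. gevrey_norm I s K (e l))"
    and "gevrey_norm I s K' (\<lambda>x. inverse (en x))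
        \<le> ennreal ((C\<^sup>2 * G) ^ n) * (\<Prod>l<n. gevrey_norm I s K (\<lambda>x. inverse (e l x)))"
    and "\<And>x. x \<in> I \<Longrightarrow> 1 < en x"
    and "gevrey_norm I s K' (\<lambda>x. angle_diff (contracted_angle (E 0 x)) (contracted_angle (iter_prod E n x)))
        \<le> ennreal \<rho>"
    and "gevrey_norm I s K' (\<lambda>x. angle_diff (expanded_angle (E (n - 1) x)) (expanded_angle (iter_prod E n x)))
        \<le> ennreal \<rho>"
proof -
  define P where "P = C * G"
  have P1: "1 \<le> P" "1000 \<le> P" unfolding P_def using C G mult_mono[of 1000 C 1 G] by auto
  have CP: "C \<le> P" unfolding P_def using C G mult_left_mono[of 1 G C] by simp
  have \<rho>1: "\<rho> \<le> 1 / 2"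
  proof -
    have "1000 \<le> P ^ 4" using power_increasing[of 1 4 P] P1 by simp
    hence "1 * 1000 * \<rho> \<le> real n * P ^ 4 * \<rho>" using n \<rho> by (intro mult_right_mono mult_mono) auto
    with small show ?thesis by (simp add: P_def)
  qed
  define N R where "N l = enn2real (gevrey_norm I s K (e l))"
    and "R l = enn2real (gevrey_norm I s K (\<lambda>x. inverse (e l x)))" for l
  have N: "gevrey_norm I s K (e l) = ennreal (N l)" if "l < n" for l
    using e(1)[OF that] by (simp add: N_def)
  have R: "gevrey_norm I s K (\<lambda>x. inverse (e l x)) = ennreal (R l)" if "l < n" for l
    using e(2)[OF that] by (simp add: R_def le_less_trans)
  have N0: "0 \<le> N l" and R0: "0 \<le> R l" for l by (simp_all add: N_def R_def)
  have R\<rho>: "R l \<le> \<rho>" if "l < n" for l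
    using e(2)[OF that] R0[of l] \<rho> unfolding R[OF that] by simp
  have bdN: "bd (e l) (N l)" and bdR: "bd (\<lambda>x. inverse (e l x)) (R l)" if "l < n" for l
    using N[OF that] R[OF that] N0 R0 by (simp_all add: bdI_norm)
  have e_gt: "1 < e l x" if "l < n" "x \<in> I" for l x
  proof -
    have "\<bar>inverse (e l x)\<bar> \<le> \<rho> / 4"
      using bd_abs_le[OF bdR[OF that(1)] that(2)] R\<rho>[OF that(1)] by simp
    moreover have "1 \<le> e l x" unfolding e_def by (rule opnorm_ge_1[OF E[OF that]])
    ultimately show ?thesis using \<rho>1 by (cases "e l x = 1") auto
  qed
  have svd: "has_svd (E l x) (e l x) (sa l x) (ua l x)" if "l < n" "x \<in> I" for l x
    unfolding e_def using e_gt[OF that] E[OF that] sa[OF that] ua[OF that]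
    by (intro has_svdI) (simp_all add: e_def)
  obtain k where k: "n = Suc k" using n by (cases n) auto
  have \<theta>: "\<theta> (Suc l) x = ua l x - sa (Suc l) x + pi / 2" for l x by (simp add: \<theta>_def)
  have "\<exists>a \<nu> \<mu>. (\<forall>x\<in>I. has_svd (iter_prod E (Suc k) x) (a x) (sa 0 x - \<nu> x) (ua k x + \<mu> x)
            \<and> 1 < a x \<and> (\<Prod>l\<le>k. e l x) / P ^ k \<le> a x)
     \<and> bd a (C ^ (2 * k) * (\<Prod>l\<le>k. N l)) \<and> bd (\<lambda>x. inverse (a x)) ((C * P) ^ k * (\<Prod>l\<le>k. R l))
     \<and> (C * P) ^ k * (\<Prod>l\<le>k. R l) \<le> \<rho>
     \<and> bd \<nu> (real k * (\<rho> / real n)) \<and> bd \<mu> (\<rho> / real n)"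
  proof (rule svd_iterate[OF C CP \<rho>])
    fix l assume "l < k"
    hence l: "1 \<le> Suc l" "Suc l < n" by (auto simp: k)
    show "cos (ua l x - sa (Suc l) x + pi / 2) \<noteq> 0" if "x \<in> I" for x
      using trig(1)[OF l that] by (simp add: \<theta>)
    show "bd (\<lambda>x. cos (ua l x - sa (Suc l) x + pi / 2)) C"
      "bd (\<lambda>x. 1 / cos (ua l x - sa (Suc l) x + pi / 2)) P"
      "bd (\<lambda>x. tan (ua l x - sa (Suc l) x + pi / 2)) P"
      using trig(2-4)[OF l] C P1 by (auto intro!: bdI_norm simp: \<theta> P_def)
  qed (use n small svd e_gt bdN bdR R\<rho> in \<open>auto simp: k P_def less_Suc_eq_le\<close>)
  then obtain a \<nu> \<mu> where a: "\<And>x. x \<in> I \<Longrightarrow> has_svd (iter_prod E n x) (a x) (sa 0 x - \<nu> x) (ua k x + \<mu> x)"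
      "\<And>x. x \<in> I \<Longrightarrow> 1 < a x" "\<And>x. x \<in> I \<Longrightarrow> (\<Prod>l\<le>k. e l x) / P ^ k \<le> a x"
    and bda: "bd a (C ^ (2 * k) * (\<Prod>l\<le>k. N l))" "bd (\<lambda>x. inverse (a x)) ((C * P) ^ k * (\<Prod>l\<le>k. R l))"
      "bd \<nu> (real k * (\<rho> / real n))" "bd \<mu> (\<rho> / real n)"
    unfolding k by blast
  have en: "en x = a x" if "x \<in> I" for x
    unfolding en_def using has_svd_opnorm[OF a(1)] a(2) that by (simp add: less_imp_le)
  show gt1: "\<And>x. x \<in> I \<Longrightarrow> 1 < en x" using a(2) en by simp
  have atMost: "{..k} = {..<n}" by (simp add: k lessThan_Suc_atMost)
  show "(\<Prod>l<n. INF x\<in>I. e l x) / (C * G) ^ n \<le> (INF x\<in>I. en x)"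
  proof (rule cINF_greatest[OF I_nonempty])
    fix x assume x: "x \<in> I"
    have lower: "0 \<le> (INF x\<in>I. e l x)" "(INF x\<in>I. e l x) \<le> e l x" if "l < n" for l
    proof -
      show "0 \<le> (INF x\<in>I. e l x)"
        using e_gt[OF that] by (intro cINF_greatest[OF I_nonempty]) (meson less_imp_le less_trans zero_less_one)
      have "bdd_below (e l ` I)" using e_gt[OF that] by (intro bdd_belowI[of _ 1]) (auto simp: less_imp_le)
      thus "(INF x\<in>I. e l x) \<le> e l x" by (rule cINF_lower[OF _ x])
    qed
    have "(\<Prod>l<n. INF x\<in>I. e l x) / P ^ n \<le> (\<Prod>l<n. e l x) / P ^ n"
      using lower P1 by (intro divide_right_mono prod_mono) auto
    also have "\<dots> \<le> (\<Prod>l<n. e l x) / P ^ k"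
      using P1 e_gt[OF _ x] by (intro divide_left_mono prod_nonneg power_increasing) (auto simp: k less_imp_le intro: order_trans[of 0 1])
    also have "\<dots> \<le> en x" using a(3)[OF x] by (simp add: atMost en[OF x])
    finally show "(\<Prod>l<n. INF x\<in>I. e l x) / (C * G) ^ n \<le> en x" by (simp add: P_def)
  qed
  have "bd en (C ^ (2 * n) * (\<Prod>l<n. N l))"
  proof (rule bd_cong_mono[OF bda(1) en])
    show "C ^ (2 * k) * (\<Prod>l\<le>k. N l) \<le> C ^ (2 * n) * (\<Prod>l<n. N l)"
      unfolding atMost using C N0 by (intro mult_right_mono power_increasing prod_nonneg) (auto simp: k)
  qed
  from gevrey_norm_le_of_bd[OF this KK']
  show "gevrey_norm I s K' en \<le> ennreal (C ^ (2 * n)) * (\<Prod>l<n. gevrey_norm I s K (e l))"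
    using N N0 C by (simp add: prod_ennreal ennreal_mult[symmetric] prod_nonneg)
  have "bd (\<lambda>x. inverse (en x)) ((C * P) ^ n * (\<Prod>l<n. R l))"
  proof (rule bd_cong_mono[OF bda(2)])
    have "1 \<le> C * P" using C P1 mult_mono[of 1 C 1 P] by simp
    thus "(C * P) ^ k * (\<Prod>l\<le>k. R l) \<le> (C * P) ^ n * (\<Prod>l<n. R l)"
      unfolding atMost using R0 by (intro mult_right_mono power_increasing prod_nonneg) (auto simp: k)
  qed (simp add: en)
  moreover have "C * P = C\<^sup>2 * G" by (simp add: P_def power2_eq_square)
  ultimately have "bd (\<lambda>x. inverse (en x)) ((C\<^sup>2 * G) ^ n * (\<Prod>l<n. R l))" by simp
  from gevrey_norm_le_of_bd[OF this KK']
  show "gevrey_norm I s K' (\<lambda>x. inverse (en x))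
        \<le> ennreal ((C\<^sup>2 * G) ^ n) * (\<Prod>l<n. gevrey_norm I s K (\<lambda>x. inverse (e l x)))"
    using R R0 C G by (simp add: prod_ennreal ennreal_mult[symmetric] prod_nonneg)
  have \<nu>: "bd \<nu> \<rho>" by (rule bd_mono[OF bda(3)]) (use \<rho> n in \<open>simp add: k field_simps\<close>)
  have \<mu>: "bd \<mu> \<rho>" by (rule bd_mono[OF bda(4)]) (use \<rho> n divide_left_mono[of 1 "real n" \<rho>] in simp)
  have angle_small: "\<bar>f x\<bar> < pi / 2" if "bd f \<rho>" "x \<in> I" for f x
    using bd_abs_le[OF that] \<rho>1 pi_gt3 by linarith
  have "bd (\<lambda>x. angle_diff (contracted_angle (E 0 x)) (contracted_angle (iter_prod E n x))) \<rho>"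
  proof (rule bd_cong[OF \<nu>])
    fix x assume x: "x \<in> I"
    have "0 < n" by (simp add: k)
    thus "angle_diff (contracted_angle (E 0 x)) (contracted_angle (iter_prod E n x)) = \<nu> x"
      using angle_diff_class[of "sa 0 x" "sa 0 x - \<nu> x"] angle_small[OF \<nu> x]
      by (simp add: has_svd_contracted[OF svd e_gt] has_svd_contracted[OF a(1,2)] x)
  qed
  thus "gevrey_norm I s K' (\<lambda>x. angle_diff (contracted_angle (E 0 x)) (contracted_angle (iter_prod E n x)))
        \<le> ennreal \<rho>" by (rule gevrey_norm_le_of_bd[OF _ KK'])
  have "bd (\<lambda>x. angle_diff (expanded_angle (E (n - 1) x)) (expanded_angle (iter_prod E n x))) \<rho>"
  proof (rule bd_cong[OF bd_minus[OF \<mu>]])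
    fix x assume x: "x \<in> I"
    have "k < n" "n - 1 = k" by (simp_all add: k)
    thus "angle_diff (expanded_angle (E (n - 1) x)) (expanded_angle (iter_prod E n x)) = - \<mu> x"
      using angle_diff_class[of "ua k x" "ua k x + \<mu> x"] angle_small[OF \<mu> x]
      by (simp add: has_svd_expanded[OF svd e_gt] has_svd_expanded[OF a(1,2)] x)
  qed
  thus "gevrey_norm I s K' (\<lambda>x. angle_diff (expanded_angle (E (n - 1) x)) (expanded_angle (iter_prod E n x)))
        \<le> ennreal \<rho>" by (rule gevrey_norm_le_of_bd[OF _ KK'])
qed

end

section \<open>Denominators of convergents and separation of scales\<close>

lemma cf_complete_quotient_irrational: "\<alpha> \<notin> \<rat> \<Longrightarrow> cf_complete_quotient \<alpha> k \<notin> \<rat>"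
proof (induction k)
  case (Suc k)
  let ?x = "cf_complete_quotient \<alpha> k"
  have "?x \<in> \<rat>" if "1 / frac ?x \<in> \<rat>"
  proof -
    have "inverse (1 / frac ?x) + of_int \<lfloor>?x\<rfloor> \<in> \<rat>"
      using that by (intro Rats_add Rats_inverse Rats_of_int)
    thus ?thesis by (simp add: frac_def)
  qed
  thus ?case using Suc.IH[OF Suc.prems] unfolding cf_complete_quotient.simps by (rule contrapos_nn[rotated])
qed simp

lemma cf_partial_quotient_ge_1: "\<alpha> \<notin> \<rat> \<Longrightarrow> 1 \<le> cf_partial_quotient \<alpha> (Suc k)"
proof -
  assume "\<alpha> \<notin> \<rat>"
  hence "cf_complete_quotient \<alpha> k \<notin> \<int>"
    using cf_complete_quotient_irrational Ints_subset_Rats by blast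
  hence "0 < frac (cf_complete_quotient \<alpha> k)" by (simp add: frac_gt_0_iff)
  thus ?thesis using frac_lt_1[of "cf_complete_quotient \<alpha> k"]
    by (simp add: cf_partial_quotient_def le_floor_iff)
qed

lemma cf_denom_ge_1:
  assumes "\<alpha> \<notin> \<rat>"
  shows "1 \<le> cf_denom \<alpha> k"
proof (induction k rule: induct_nat_012)
  case (ge2 k)
  have "1 * 1 \<le> cf_partial_quotient \<alpha> (Suc (Suc k)) * cf_denom \<alpha> (Suc k)"
    using ge2 cf_partial_quotient_ge_1[OF assms, of "Suc k"] by (intro mult_mono) auto
  with ge2 show ?case by simp
next
  case 1
  then show ?case using cf_partial_quotient_ge_1[OF assms, of 0] by simp
qed simp

text \<open>For \<open>q = q\<^bsub>m-1\<^esub>\<close> and \<open>r = q\<^sub>m \<le> M q\<close>, the number of factors and the powers of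
\<open>exp (r\<^sup>\<gamma>)\<close> are at most exponential in \<open>q\<close> at a rate that depends only on \<open>C\<close> and \<open>M\<close>, using
\<open>x \<le> exp x\<close> throughout. A negative power of \<open>lam\<close> with exponent proportional to \<open>q\<close> beats
them as soon as \<open>ln lam\<close> exceeds a fixed multiple of that rate.\<close>

lemma scale_separation:
  fixes C M q r \<gamma> lam n :: real
  assumes C: "1 \<le> C" and M: "0 < M" and q: "1 \<le> q" and r: "1 \<le> r" "r \<le> M * q"
    and \<gamma>: "\<gamma> \<le> 1" and n: "0 \<le> n" "n \<le> r powr C + 1"
    and lam: "exp (3 * (2 * C ^ 5 + C * M + 4 * M)) \<le> lam"
  shows "n * (C * exp (r powr \<gamma>)) ^ 4 * (C * lam powr (- (1 / 3) * q)) \<le> 1"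
    and "C * lam powr (- (1 / 3) * q) \<le> lam powr (- (1 / 10) * q)"
proof -
  define D where "D = 2 * C ^ 5 + C * M + 4 * M"
  have lam0: "0 < lam" by (rule less_le_trans[OF exp_gt_zero lam])
  have lnlam: "3 * D \<le> ln lam" using lam lam0 by (simp add: ln_ge_iff D_def)
  have Mq: "M * q \<le> exp (M * q)" using exp_ge_add_one_self[of "M * q"] by linarith
  have "r powr C \<le> exp (M * q) powr C" using r Mq C by (intro powr_mono2) auto
  also have "\<dots> = exp (C * M * q)" by (simp add: powr_def mult_ac)
  finally have "n \<le> exp (C * M * q) + 1" using n by linarith
  moreover have "1 \<le> exp (C * M * q)" using C M q by simp
  ultimately have n': "n \<le> 2 * exp (C * M * q)" by linarith
  have "r powr \<gamma> \<le> r powr 1" using r \<gamma> by (intro powr_mono) auto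
  hence "4 * r powr \<gamma> \<le> 4 * M * q" using r by simp
  hence G4: "exp (r powr \<gamma>) ^ 4 \<le> exp (4 * M * q)" by (simp add: exp_of_nat_mult[symmetric])
  have "- (1 / 3) * q * ln lam \<le> - (1 / 3) * q * (3 * D)"
    using lnlam q by (intro mult_left_mono_neg) auto
  hence L: "lam powr (- (1 / 3) * q) \<le> exp (- (D * q))" using lam0 by (simp add: powr_def mult_ac)
  have C5: "2 * C ^ 5 \<le> exp (2 * C ^ 5 * q)"
  proof -
    have "2 * C ^ 5 * 1 \<le> 2 * C ^ 5 * q" using q C by (intro mult_left_mono) auto
    also have "\<dots> \<le> exp (2 * C ^ 5 * q)" using exp_ge_add_one_self[of "2 * C ^ 5 * q"] by linarith
    finally show ?thesis by simp
  qed
  have "n * (C * exp (r powr \<gamma>)) ^ 4 * (C * lam powr (- (1 / 3) * q))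
      = n * exp (r powr \<gamma>) ^ 4 * lam powr (- (1 / 3) * q) * C ^ 5"
    by (simp add: power_mult_distrib power_numeral_reduce)
  also have "\<dots> \<le> 2 * exp (C * M * q) * exp (4 * M * q) * exp (- (D * q)) * C ^ 5"
    using n n' G4 L C by (intro mult_right_mono mult_mono) auto
  also have "\<dots> = (2 * C ^ 5) * exp (C * M * q) * exp (4 * M * q) * exp (- (D * q))"
    by simp
  also have "\<dots> \<le> exp (2 * C ^ 5 * q) * exp (C * M * q) * exp (4 * M * q) * exp (- (D * q))"
    using C5 by (intro mult_right_mono) auto
  also have "\<dots> = 1" by (simp add: exp_add[symmetric] D_def algebra_simps)
  finally show "n * (C * exp (r powr \<gamma>)) ^ 4 * (C * lam powr (- (1 / 3) * q)) \<le> 1" .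
  have "C \<le> exp (7 / 30 * q * ln lam)"
  proof -
    have "0 < C * M" using C M by simp
    moreover have "C \<le> C ^ 5" using power_increasing[of 1 5 C] C by simp
    ultimately have "C \<le> C ^ 5 + C * M / 2 + 2 * M" using M by simp
    hence "6 * C \<le> 3 * D" by (simp add: D_def)
    hence "7 / 30 * 1 * (6 * C) \<le> 7 / 30 * q * ln lam" using lnlam q C by (intro mult_mono) auto
    hence "C \<le> 7 / 30 * q * ln lam" using C by simp
    thus ?thesis using exp_ge_add_one_self[of "7 / 30 * q * ln lam"] by linarith
  qed
  hence "C * lam powr (- (1 / 3) * q) \<le> exp (7 / 30 * q * ln lam) * lam powr (- (1 / 3) * q)"
    by (intro mult_right_mono) auto
  also have "\<dots> = lam powr (- (1 / 10) * q)"
    using lam0 by (simp add: powr_def exp_add[symmetric] algebra_simps)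
  finally show "C * lam powr (- (1 / 3) * q) \<le> lam powr (- (1 / 10) * q)" .
qed

section \<open>The choice of constants\<close>

theorem lemma4p2:
  "\<exists>C0>0. \<exists>C1>0.
    \<forall>(s::real) (\<gamma>::real) (K::real) (\<xi>::real) (\<alpha>::real) (C::real) (c::real).
     2 < s \<longrightarrow> 0 < \<gamma> \<longrightarrow> \<gamma> < 1 \<longrightarrow> 0 < K \<longrightarrow> 0 < \<xi> \<longrightarrow> \<xi> < 1 / 1000 \<longrightarrow>
     bounded_type \<alpha> \<longrightarrow> C0 \<le> C \<longrightarrow> 0 < c \<longrightarrow>
     (\<exists>lam0>1. \<exists>c'>0. \<forall>lam\<ge>lam0. \<forall>m\<ge>1. \<forall>n\<ge>2.
       (let q = (\<lambda>j. real_of_int (cf_denom \<alpha> j)) in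
        real (n - 1) \<le> q m powr C \<longrightarrow>
        (\<forall>(I::real set) (E :: nat \<Rightarrow> real \<Rightarrow> real^2^2)
           (sa :: nat \<Rightarrow> real \<Rightarrow> real) (ua :: nat \<Rightarrow> real \<Rightarrow> real).
          (let e = (\<lambda>l x. opnorm (E l x));
               \<theta> = (\<lambda>l x. ua (l - 1) x - sa l x + pi / 2);
               En = iter_prod E n;
               en = (\<lambda>x. opnorm (En x));
               \<eta> = lam powr (- (1 / 8000) * q (m - 1))
           in
           is_interval I \<longrightarrow> interior I \<noteq> {} \<longrightarrow>
           (\<forall>l\<le>n - 1. E l \<in> gevrey_SL2 I s K) \<longrightarrow>
           (\<forall>l\<le>n - 1. smooth_lift_on I (\<lambda>x. contracted_angle (E l x)) (sa l)) \<longrightarrow>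
           (\<forall>l\<le>n - 1. smooth_lift_on I (\<lambda>x. expanded_angle (E l x)) (ua l)) \<longrightarrow>
           (\<forall>l\<in>{1..n - 1}. (INF x\<in>I. \<bar>pi / 2 - \<theta> l x\<bar>) \<ge> c * exp (- (q m powr \<gamma>))) \<longrightarrow>
           c * exp (- (q m powr \<gamma>))
             \<ge> C1 * (MIN j\<in>{0..n - 1}. INF x\<in>I. e j x) powr (- (1 / 100)) \<longrightarrow>
           (\<forall>l\<in>{1..n - 1}.
              (\<forall>x\<in>I. cos (\<theta> l x) \<noteq> 0 \<and> sin (\<theta> l x) \<noteq> 0) \<and>
              gevrey_norm I s K (\<lambda>x. 1 / cos (\<theta> l x)) \<le> ennreal (C * exp (q m powr \<gamma>)) \<and>
              gevrey_norm I s K (\<lambda>x. tan (\<theta> l x)) \<le> ennreal (C * exp (q m powr \<gamma>)) \<and>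
              gevrey_norm I s K (\<lambda>x. cos (\<theta> l x)) \<le> ennreal C \<and>
              gevrey_norm I s K (\<lambda>x. cot (\<theta> l x)) \<le> ennreal C) \<longrightarrow>
           (\<forall>l\<le>n - 1.
              e l \<in> gevrey I s K \<and>
              gevrey_norm I s K (\<lambda>x. inverse (e l x))
                \<le> ennreal (enn2real (gevrey_norm I s K (e l)) powr (- 1 + \<xi>)) \<and>
              enn2real (gevrey_norm I s K (e l)) powr (- 1 + \<xi>)
                \<le> C * lam powr (- (1 / 3) * q (m - 1))) \<longrightarrow>
           (INF x\<in>I. en x)
             \<ge> c' ^ n * exp (- 2 * real n * q m powr \<gamma>) * (\<Prod>l=0..n - 1. INF x\<in>I. e l x) \<and>
           gevrey_norm I s ((1 + \<eta>) * K) en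
             \<le> ennreal (C ^ (2 * n)) * (\<Prod>l=0..n - 1. gevrey_norm I s K (e l)) \<and>
           gevrey_norm I s ((1 + \<eta>) * K) (\<lambda>x. inverse (en x))
             \<le> ennreal (C ^ (2 * n) * exp (4 * real n * q m powr \<gamma>)) *
                 (\<Prod>l=0..n - 1. gevrey_norm I s K (\<lambda>x. inverse (e l x))) \<and>
           (\<forall>x\<in>I. en x > 1) \<and>
           gevrey_norm I s ((1 + \<eta>) * K)
               (\<lambda>x. angle_diff (contracted_angle (E 0 x)) (contracted_angle (En x)))
             \<le> ennreal (lam powr (- (1 / 10) * q (m - 1))) \<and>
           gevrey_norm I s ((1 + \<eta>) * K)
               (\<lambda>x. angle_diff (expanded_angle (E (n - 1) x)) (expanded_angle (En x)))
             \<le> ennreal (lam powr (- (1 / 10) * q (m - 1)))))))"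
proof (rule exI[of _ 1000], rule conjI, simp, rule exI[of _ 1], rule conjI, simp, intro allI impI, goal_cases)
  case (1 s \<gamma> K \<xi> \<alpha> C c)
  then have s: "2 < s" and \<gamma>: "0 < \<gamma>" "\<gamma> < 1" and K: "0 < K" and C: "1000 \<le> C"
    by simp_all
  obtain M where irr: "\<alpha> \<notin> \<rat>" and M: "0 < M"
    and qM: "\<And>m. real_of_int (cf_denom \<alpha> (Suc m)) \<le> M * real_of_int (cf_denom \<alpha> m)"
    using 1(7) unfolding bounded_type_def by blast
  define lam0 where "lam0 = exp (3 * (2 * C ^ 5 + C * M + 4 * M))"
  have lam0: "1 < lam0"
    using C M by (simp add: lam0_def add_pos_pos)
  \<comment> \<open>Each multiplication loses at most a factor \<open>C exp (q\<^sub>m\<^sup>\<gamma>)\<close> in the norm, whence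
    \<open>c' = 1 / C\<close>.\<close>
  have C': "0 < 1 / C" using C by simp
  show ?case
    unfolding Let_def
  proof (rule exI[of _ lam0], rule conjI, rule lam0, rule exI[of _ "1 / C"], rule conjI, rule C', intro allI impI, goal_cases)
    case (1 lam m n I E sa ua)
    \<comment> \<open>\<open>\<rho>\<close> bounds the norms of the reciprocals \<open>1/e l\<close> by hypothesis; \<open>G\<close> bounds
      \<open>1/cos \<theta>\<close> and \<open>tan \<theta>\<close> up to the factor \<open>C\<close>.\<close>
    define q r where "q = real_of_int (cf_denom \<alpha> (m - 1))" and "r = real_of_int (cf_denom \<alpha> m)"
    define G where "G = exp (r powr \<gamma>)"
    define \<rho> where "\<rho> = C * lam powr (- (1 / 3) * q)"
    define \<eta> where "\<eta> = lam powr (- (1 / 8000) * q)"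
    define K' where "K' = (1 + \<eta>) * K"
    note hyps = 1[folded q_def r_def]
    have lam: "lam0 \<le> lam" and m: "1 \<le> m" and n: "2 \<le> n" by (rule hyps)+
    have q1: "1 \<le> q" and r1: "1 \<le> r"
      using cf_denom_ge_1[OF irr] by (simp_all add: q_def r_def)
    have rq: "r \<le> M * q" using qM[of "m - 1"] m by (simp add: q_def r_def)
    have nr: "real n \<le> r powr C + 1" using hyps(4) n by simp
    have small: "real n * (C * G) ^ 4 * \<rho> \<le> 1" and \<rho>_le: "\<rho> \<le> lam powr (- (1 / 10) * q)"
      unfolding G_def \<rho>_def
      by (rule scale_separation[where \<gamma> = \<gamma>, OF _ M q1 r1 rq _ _ nr lam[unfolded lam0_def]]; use C \<gamma> in simp)+
    have G: "1 \<le> G" by (simp add: G_def)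
    have \<rho>: "0 < \<rho>" using C lam lam0 by (simp add: \<rho>_def)
    have KK': "K \<le> K'" using K by (simp add: K'_def \<eta>_def)
    interpret gevrey_interval I s K
      using hyps(5,6) s K by unfold_locales auto
    have n1: "1 \<le> n" and range: "{0..n - 1} = {..<n}" using n by auto
    have E: "det (E l x) = 1" if "l < n" "x \<in> I" for l x
      using hyps(7) that unfolding gevrey_SL2_def by simp
    have sa: "sa l x \<in> contracted_angle (E l x)" and ua: "ua l x \<in> expanded_angle (E l x)"
      if "l < n" "x \<in> I" for l x
      using hyps(8,9) that unfolding smooth_lift_on_def by simp_all
    have norms: "gevrey_norm I s K (\<lambda>x. opnorm (E l x)) < \<infinity>"
        "gevrey_norm I s K (\<lambda>x. inverse (opnorm (E l x))) \<le> ennreal \<rho>" if "l < n" for l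
    proof -
      have h: "(\<lambda>x. opnorm (E l x)) \<in> gevrey I s K"
        "gevrey_norm I s K (\<lambda>x. inverse (opnorm (E l x)))
          \<le> ennreal (enn2real (gevrey_norm I s K (\<lambda>x. opnorm (E l x))) powr (- 1 + \<xi>))"
        "enn2real (gevrey_norm I s K (\<lambda>x. opnorm (E l x))) powr (- 1 + \<xi>) \<le> \<rho>"
        using hyps(13) that unfolding \<rho>_def by simp_all
      show "gevrey_norm I s K (\<lambda>x. opnorm (E l x)) < \<infinity>" using h(1) by (simp add: gevrey_def)
      show "gevrey_norm I s K (\<lambda>x. inverse (opnorm (E l x))) \<le> ennreal \<rho>"
        using h(2) ennreal_leI[OF h(3)] by (rule order_trans)
    qed
    have trig: "x \<in> I \<Longrightarrow> cos (ua (l - 1) x - sa l x + pi / 2) \<noteq> 0"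
      "gevrey_norm I s K (\<lambda>x. 1 / cos (ua (l - 1) x - sa l x + pi / 2)) \<le> ennreal (C * G)"
      "gevrey_norm I s K (\<lambda>x. tan (ua (l - 1) x - sa l x + pi / 2)) \<le> ennreal (C * G)"
      "gevrey_norm I s K (\<lambda>x. cos (ua (l - 1) x - sa l x + pi / 2)) \<le> ennreal C"
      if "1 \<le> l" "l < n" for l x
    proof -
      have "l \<in> {1..n - 1}" using that by simp
      from bspec[OF hyps(12) this] show "x \<in> I \<Longrightarrow> cos (ua (l - 1) x - sa l x + pi / 2) \<noteq> 0"
        "gevrey_norm I s K (\<lambda>x. 1 / cos (ua (l - 1) x - sa l x + pi / 2)) \<le> ennreal (C * G)"
        "gevrey_norm I s K (\<lambda>x. tan (ua (l - 1) x - sa l x + pi / 2)) \<le> ennreal (C * G)"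
        "gevrey_norm I s K (\<lambda>x. cos (ua (l - 1) x - sa l x + pi / 2)) \<le> ennreal C"
        unfolding G_def by blast+
    qed
    note est = product_estimates[where E = E and sa = sa and ua = ua, OF C G \<rho> n1 KK' small E sa ua trig norms]
    have G_pow: "exp (k * real n * r powr \<gamma>) = G ^ (j * n)" if "k = real j" for k j
      by (simp add: G_def that exp_of_nat_mult[symmetric] mult_ac)
    show ?case
      unfolding q_def[symmetric] r_def[symmetric] \<eta>_def[symmetric] K'_def[symmetric] range
    proof (intro conjI)
      have nonneg: "0 \<le> (\<Prod>l<n. INF x\<in>I. opnorm (E l x))"
        using opnorm_ge_1[OF E] by (intro prod_nonneg ballI cINF_greatest[OF I_nonempty]) (force intro: order_trans[of 0 1])
      have "(1 / C) ^ n * exp (- 2 * real n * r powr \<gamma>) \<le> 1 / (C * G) ^ n"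
      proof -
        have "exp (- 2 * real n * r powr \<gamma>) = 1 / G ^ (2 * n)"
          using G_pow[of 2 2] by (simp add: exp_minus divide_inverse)
        also have "\<dots> \<le> 1 / G ^ n" using G by (intro divide_left_mono power_increasing) auto
        finally have "(1 / C) ^ n * exp (- 2 * real n * r powr \<gamma>) \<le> (1 / C) ^ n * (1 / G ^ n)"
          using C by (intro mult_left_mono) auto
        thus ?thesis by (simp add: power_mult_distrib power_divide)
      qed
      hence "(1 / C) ^ n * exp (- 2 * real n * r powr \<gamma>) * (\<Prod>l<n. INF x\<in>I. opnorm (E l x))
          \<le> 1 / (C * G) ^ n * (\<Prod>l<n. INF x\<in>I. opnorm (E l x))"
        using nonneg by (rule mult_right_mono)
      also have "\<dots> \<le> (INF x\<in>I. opnorm (iter_prod E n x))" using est(1) by simp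
      finally show "(1 / C) ^ n * exp (- 2 * real n * r powr \<gamma>) * (\<Prod>l<n. INF x\<in>I. opnorm (E l x))
          \<le> (INF x\<in>I. opnorm (iter_prod E n x))" .
    next
      show "gevrey_norm I s K' (\<lambda>x. opnorm (iter_prod E n x))
          \<le> ennreal (C ^ (2 * n)) * (\<Prod>l<n. gevrey_norm I s K (\<lambda>x. opnorm (E l x)))" by (rule est(2))
    next
      have "(C\<^sup>2 * G) ^ n = C ^ (2 * n) * G ^ n" by (simp add: power_mult_distrib power_mult)
      also have "\<dots> \<le> C ^ (2 * n) * G ^ (4 * n)"
        using G C by (intro mult_left_mono power_increasing) auto
      also have "\<dots> = C ^ (2 * n) * exp (4 * real n * r powr \<gamma>)" using G_pow[of 4 4] by simp
      finally have "(C\<^sup>2 * G) ^ n \<le> C ^ (2 * n) * exp (4 * real n * r powr \<gamma>)" .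
      from order_trans[OF est(3) mult_right_mono[OF ennreal_leI[OF this]]]
      show "gevrey_norm I s K' (\<lambda>x. inverse (opnorm (iter_prod E n x)))
          \<le> ennreal (C ^ (2 * n) * exp (4 * real n * r powr \<gamma>)) *
            (\<Prod>l<n. gevrey_norm I s K (\<lambda>x. inverse (opnorm (E l x))))" by simp
    next
      show "\<forall>x\<in>I. 1 < opnorm (iter_prod E n x)" using est(4) by blast
    next
      show "gevrey_norm I s K'
          (\<lambda>x. angle_diff (contracted_angle (E 0 x)) (contracted_angle (iter_prod E n x)))
          \<le> ennreal (lam powr (- (1 / 10) * q))"
        by (rule order_trans[OF est(5) ennreal_leI[OF \<rho>_le]])
      show "gevrey_norm I s K'
          (\<lambda>x. angle_diff (expanded_angle (E (n - 1) x)) (expanded_angle (iter_prod E n x)))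
          \<le> ennreal (lam powr (- (1 / 10) * q))"
        by (rule order_trans[OF est(6) ennreal_leI[OF \<rho>_le]])
    qed
  qed
qed

end
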